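(* Let $1\le p<\infty$. Let $F:\mathbb{T}\to\mathbb{C}$ be such that $t\mapsto F(e^{it})$ is absolutely continuous on $[0,2\pi]$ (with $F(e^{i0})=F(e^{i2\pi})$), and suppose $\dot F\in L^p(0,2\pi)$, where $\dot F(e^{it})=\frac{d}{dt}F(e^{it})$ (defined a.e.). Let $w=P[F]$ be the Poisson integral of $F$. Then, writing $z=re^{i\theta}\in\mathbb{D}$ and $w_r=\partial w/\partial r$, $$\|w_r\|_{L^p}\le \big(2C(p)\big)^{1/p}\,\|\dot F\|_{L^p},$$ where $$C(p)=\int_0^1 \left(\frac{4\tanh^{-1}r}{\pi r}\right)^p r\,dr<\infty .$$ In particular $w_r\in L^p(\mathbb{D})$.
   Context: $\mathbb{D}$ is the open unit disk and $\mathbb{T}$ the unit circle. For $F\in L^1(\mathbb{T})$, the Poisson integral is $P[F](re^{i\theta})=\int_0^{2\pi}P_r(t-\theta)F(e^{it})\,dt$ with $P_r(t-\theta)=\frac{1}{2\pi}\frac{1-r^2}{1-2r\cos(t-\theta)+r^2}$. For $G$ on $[0,2\pi]$, $\|G\|_{L^p}=\left(\frac{1}{2\pi}\int_0^{2\pi}|G(e^{it})|^p\,dt\right)^{1/p}$ for $1\le p<\infty$. For a function $f$ on $\mathbb{D}$, the Bergman norm is $\|f\|_{L^p}=\left(\int_{\mathbb{D}}|f|^p\,dA\right)^{1/p}$, where $dA=\frac{1}{\pi}dx\,dy=\frac1\pi r\,dr\,d\theta$ is normalized area measure; $L^p(\mathbb{D})$ is the space of functions with finite such norm. $\tanh^{-1}r=\frac12\log\frac{1+r}{1-r}$.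 *)

theory Defs
  imports "HOL-Analysis.Analysis"
begin

definition abs_continuous_on :: "real set \<Rightarrow> (real \<Rightarrow> 'a::real_normed_vector) \<Rightarrow> bool" where
  "abs_continuous_on S f \<longleftrightarrow>
     (\<forall>e>0. \<exists>d>0. \<forall>n::nat. \<forall>a b :: nat \<Rightarrow> real.
        (\<forall>k<n. a k \<in> S \<and> b k \<in> S \<and> a k \<le> b k) \<and>
        (\<forall>j<n. \<forall>k<n. j \<noteq> k \<longrightarrow> b j \<le> a k \<or> b k \<le> a j) \<and>
        (\<Sum>k<n. b k - a k) < d
        \<longrightarrow> (\<Sum>k<n. norm (f (b k) - f (a k))) < e)"

definition poisson_kernel :: "real \<Rightarrow> real \<Rightarrow> real" where
  "poisson_kernel r s = (1 / (2*pi)) * (1 - r^2) / (1 - 2*r*cos s + r^2)"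

definition poisson_polar :: "(complex \<Rightarrow> complex) \<Rightarrow> real \<Rightarrow> real \<Rightarrow> complex" where
  "poisson_polar F r \<theta> = (LBINT t=0..2*pi. complex_of_real (poisson_kernel r (t - \<theta>)) * F (cis t))"

definition poisson_integral :: "(complex \<Rightarrow> complex) \<Rightarrow> complex \<Rightarrow> complex" where
  "poisson_integral F z = poisson_polar F (cmod z) (Arg z)"

definition poisson_radial_deriv :: "(complex \<Rightarrow> complex) \<Rightarrow> complex \<Rightarrow> complex" where
  "poisson_radial_deriv F z =
     vector_derivative (\<lambda>s. poisson_integral F (complex_of_real s * cis (Arg z))) (at (cmod z))"

definition circle_Lp_norm :: "real \<Rightarrow> (real \<Rightarrow> complex) \<Rightarrow> real" where
  "circle_Lp_norm p G = ((1/(2*pi)) * (LBINT t=0..2*pi. norm (G t) powr p)) powr (1/p)"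

definition bergman_Lp_norm :: "real \<Rightarrow> (complex \<Rightarrow> complex) \<Rightarrow> real" where
  "bergman_Lp_norm p f = ((1/pi) * (LINT z:ball 0 1|lborel. norm (f z) powr p)) powr (1/p)"

definition C_const :: "real \<Rightarrow> real" where
  "C_const p = (LBINT r=0..1. (4 * artanh r / (pi * r)) powr p * r)"

end

theory Submission
  imports Defs
begin

text \<open>The radial derivative of the Poisson kernel is the angular derivative of the conjugate kernel
  \<open>K\<^sub>r(s) = sin s / (\<pi> (1 - 2 r cos s + r\<^sup>2))\<close>, so integration by parts, which is legitimate for
  absolutely continuous \<open>F\<close>, expresses \<open>w\<^sub>r\<close> as the convolution of \<open>dF/dt\<close> with \<open>-K\<^sub>r\<close>. The
  \<open>L\<^sup>1\<close> norm of \<open>K\<^sub>r\<close> is \<open>4 artanh r / (\<pi> r)\<close>. Jensen's inequality with respect to the measure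
  \<open>|K\<^sub>r|\<close> bounds \<open>|w\<^sub>r|\<^sup>p\<close> pointwise, and Tonelli's theorem together with rotation invariance of the
  area measure gives the estimate on the disc.\<close>

subsection \<open>Absolutely continuous functions\<close>

text \<open>No change to polar coordinates is carried out. After Jensen the weight in front of
  |dF/dt|^p depends on z and t only through the rotated point z e^{-it}. Its integral over z is
  therefore a number J independent of t, and the double integral factors as J times the integral of
  |dF/dt|^p. Integrating the weight over t instead gives the p-th power of the L^1 norm of K_r, a
  radial function, whence 2 pi J = 2 pi C(p); for this the push-forward of area under the modulus is
  enough. The factor 2 in 2 C(p) is a matter of normalisation: area is divided by pi, arc length by
  2 pi. The obstacle in the integration by parts is that F is differentiable only almost everywhere.
  The fundamental theorem is therefore proved for absolutely continuous functions and applied to the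
  product of F with the kernel. The origin, where the angle is not defined, is a null set and is
  left out of every pointwise formula for w_r.\<close>

lemma abs_continuous_on_finite_sets:
  assumes "abs_continuous_on S f" "e > 0"
  shows "\<exists>d>0. \<forall>(q :: 'i set) A B. finite q \<and> (\<forall>i\<in>q. A i \<in> S \<and> B i \<in> S \<and> A i \<le> B i) \<and>
       (\<forall>i\<in>q. \<forall>j\<in>q. i \<noteq> j \<longrightarrow> B i \<le> A j \<or> B j \<le> A i) \<and> (\<Sum>i\<in>q. B i - A i) < d \<longrightarrow>
       (\<Sum>i\<in>q. norm (f (B i) - f (A i))) < e"
proof -
  obtain d where "d > 0" and d: "\<forall>n::nat. \<forall>a b :: nat \<Rightarrow> real.
      (\<forall>k<n. a k \<in> S \<and> b k \<in> S \<and> a k \<le> b k) \<and>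
      (\<forall>j<n. \<forall>k<n. j \<noteq> k \<longrightarrow> b j \<le> a k \<or> b k \<le> a j) \<and>
      (\<Sum>k<n. b k - a k) < d \<longrightarrow> (\<Sum>k<n. norm (f (b k) - f (a k))) < e"
    using assms(1)[unfolded abs_continuous_on_def, THEN spec, THEN mp, OF assms(2)] by blast
  show ?thesis
  proof (intro exI[of _ d] conjI \<open>d > 0\<close> allI impI, elim conjE)
    fix q :: "'i set" and A B :: "'i \<Rightarrow> real"
    assume q: "finite q" "\<forall>i\<in>q. A i \<in> S \<and> B i \<in> S \<and> A i \<le> B i"
      "\<forall>i\<in>q. \<forall>j\<in>q. i \<noteq> j \<longrightarrow> B i \<le> A j \<or> B j \<le> A i" "(\<Sum>i\<in>q. B i - A i) < d"
    \<comment> \<open>Enumerating \<open>q\<close> turns a family over a finite set, such as the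
      pairs of a tagged division, into the numbered list that the definition of absolute continuity
      expects.\<close>
    obtain h where h: "bij_betw h {..<card q} q"
      using ex_bij_betw_nat_finite[OF q(1)] by (auto simp: atLeast0LessThan)
    have inq: "h k \<in> q" if "k < card q" for k using h that by (auto dest: bij_betwE)
    have inj: "h j \<noteq> h k" if "j < card q" "k < card q" "j \<noteq> k" for j k
      using h that by (auto simp: bij_betw_def inj_on_def)
    have "(\<Sum>k<card q. norm (f (B (h k)) - f (A (h k)))) < e"
    proof (rule d[THEN spec, THEN spec, THEN spec, THEN mp], intro conjI allI impI)
      show "(\<Sum>k<card q. B (h k) - A (h k)) < d"
        using q(4) sum.reindex_bij_betw[OF h, of "\<lambda>i. B i - A i"] by simp
      show "B (h j) \<le> A (h k) \<or> B (h k) \<le> A (h j)" if "j < card q" "k < card q" "j \<noteq> k" for j k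
        using q(3) inq inj that by blast
    qed (use q(2) inq in auto)
    then show "(\<Sum>i\<in>q. norm (f (B i) - f (A i))) < e"
      using sum.reindex_bij_betw[OF h, of "\<lambda>i. norm (f (B i) - f (A i))"] by simp
  qed
qed

lemma abs_continuous_on_imp_continuous_on:
  assumes "abs_continuous_on {a..b} f"
  shows "continuous_on {a..b} f"
  unfolding continuous_on_iff
proof (intro ballI allI impI)
  fix x and e :: real assume x: "x \<in> {a..b}" and "e > 0"
  obtain d where "d > 0" and d: "\<forall>(q :: unit set) A B. finite q \<and>
       (\<forall>i\<in>q. A i \<in> {a..b} \<and> B i \<in> {a..b} \<and> A i \<le> B i) \<and>
       (\<forall>i\<in>q. \<forall>j\<in>q. i \<noteq> j \<longrightarrow> B i \<le> A j \<or> B j \<le> A i) \<and> (\<Sum>i\<in>q. B i - A i) < d \<longrightarrow>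
       (\<Sum>i\<in>q. norm (f (B i) - f (A i))) < e"
    using abs_continuous_on_finite_sets[OF assms \<open>e > 0\<close>, where ?'i = unit] by blast
  have "dist (f y) (f x) < e" if y: "y \<in> {a..b}" "dist y x < d" for y
    \<comment> \<open>A single interval, indexed by the only element of \<open>unit\<close>.\<close>
    using d[rule_format, of "{()}" "\<lambda>_. min x y" "\<lambda>_. max x y"] x y
    by (cases "x \<le> y") (auto simp: min_def max_def dist_norm norm_minus_commute)
  with \<open>d > 0\<close> show "\<exists>d>0. \<forall>x'\<in>{a..b}. dist x' x < d \<longrightarrow> dist (f x') (f x) < e" by blast
qed

text \<open>The usual splitting of an increment of a product, with both factors bounded by
  compactness. It lets integration by parts be read off from the fundamental theorem applied to
  kernel times F.\<close>

lemma abs_continuous_on_scaleR: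
  fixes f :: "real \<Rightarrow> 'a::real_normed_vector" and k :: "real \<Rightarrow> real"
  assumes f: "abs_continuous_on {a..b} f" and k: "L-lipschitz_on {a..b} k"
  shows "abs_continuous_on {a..b} (\<lambda>t. k t *\<^sub>R f t)"
proof -
  have "bounded (f ` {a..b})" "bounded (k ` {a..b})"
    using abs_continuous_on_imp_continuous_on[OF f] lipschitz_on_continuous_on[OF k]
    by (auto intro!: compact_imp_bounded compact_continuous_image)
  then obtain M1 M2 where M: "M1 > 0" "\<And>x. x \<in> {a..b} \<Longrightarrow> norm (f x) \<le> M1"
      "M2 > 0" "\<And>x. x \<in> {a..b} \<Longrightarrow> \<bar>k x\<bar> \<le> M2"
    unfolding bounded_pos by auto
  have L: "L \<ge> 0" using k by (auto simp: lipschitz_on_def)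
  show ?thesis
    unfolding abs_continuous_on_def
  proof (intro allI impI)
    fix e :: real assume "e > 0"
    with M have e': "e / (2 * M2) > 0" by simp
    obtain d where d: "d > 0" and ac: "\<forall>n::nat. \<forall>A B :: nat \<Rightarrow> real.
      (\<forall>k<n. A k \<in> {a..b} \<and> B k \<in> {a..b} \<and> A k \<le> B k) \<and>
      (\<forall>j<n. \<forall>k<n. j \<noteq> k \<longrightarrow> B j \<le> A k \<or> B k \<le> A j) \<and>
      (\<Sum>k<n. B k - A k) < d \<longrightarrow> (\<Sum>k<n. norm (f (B k) - f (A k))) < e / (2 * M2)"
      using f[unfolded abs_continuous_on_def, THEN spec, THEN mp, OF e'] by blast
    \<comment> \<open>The second bound makes the Lipschitz part
      \<open>L * M1 * (\<Sum>i<n. B i - A i)\<close> at most e/2; \<open>L + 1\<close> in place of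
      \<open>L\<close> keeps the denominator positive when \<open>L = 0\<close>.\<close>
    define d' where "d' = min d (e / (2 * M1 * (L + 1)))"
    have d': "d' > 0" using d \<open>e > 0\<close> M L by (simp add: d'_def)
    show "\<exists>d>0. \<forall>n::nat. \<forall>A B. (\<forall>k<n. A k \<in> {a..b} \<and> B k \<in> {a..b} \<and> A k \<le> B k) \<and>
          (\<forall>j<n. \<forall>k<n. j \<noteq> k \<longrightarrow> B j \<le> A k \<or> B k \<le> A j) \<and> (\<Sum>k<n. B k - A k) < d \<longrightarrow>
          (\<Sum>i<n. norm (k (B i) *\<^sub>R f (B i) - k (A i) *\<^sub>R f (A i))) < e"
    proof (intro exI[of _ d'] conjI d' allI impI)
      fix n and A B :: "nat \<Rightarrow> real"
      assume *: "(\<forall>k<n. A k \<in> {a..b} \<and> B k \<in> {a..b} \<and> A k \<le> B k) \<and>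
          (\<forall>j<n. \<forall>k<n. j \<noteq> k \<longrightarrow> B j \<le> A k \<or> B k \<le> A j) \<and> (\<Sum>k<n. B k - A k) < d'"
      have 1: "(\<Sum>k<n. norm (f (B k) - f (A k))) < e / (2 * M2)"
        using * by (intro ac[rule_format, OF conjI[OF _ conjI]]) (auto simp: d'_def)
      have "norm (k (B i) *\<^sub>R f (B i) - k (A i) *\<^sub>R f (A i)) 
          \<le> M2 * norm (f (B i) - f (A i)) + L * M1 * (B i - A i)" if i: "i < n" for i
      proof -
        have AB: "A i \<in> {a..b}" "B i \<in> {a..b}" "A i \<le> B i" using * i by auto
        have "k (B i) *\<^sub>R f (B i) - k (A i) *\<^sub>R f (A i) 
           = k (B i) *\<^sub>R (f (B i) - f (A i)) + (k (B i) - k (A i)) *\<^sub>R f (A i)"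
          by (simp add: algebra_simps)
        also have "norm \<dots> \<le> \<bar>k (B i)\<bar> * norm (f (B i) - f (A i)) + \<bar>k (B i) - k (A i)\<bar> * norm (f (A i))"
          by (metis norm_scaleR norm_triangle_ineq)
        also have "\<dots> \<le> M2 * norm (f (B i) - f (A i)) + (L * (B i - A i)) * M1"
          using AB M lipschitz_onD[OF k, of "B i" "A i"] L
          by (intro add_mono mult_mono) (auto simp: dist_real_def)
        finally show ?thesis by (simp add: algebra_simps)
      qed
      then have "(\<Sum>i<n. norm (k (B i) *\<^sub>R f (B i) - k (A i) *\<^sub>R f (A i)))
         \<le> (\<Sum>i<n. M2 * norm (f (B i) - f (A i)) + L * M1 * (B i - A i))"
        by (intro sum_mono) auto
      also have "\<dots> = M2 * (\<Sum>i<n. norm (f (B i) - f (A i))) + L * M1 * (\<Sum>i<n. B i - A i)"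
        by (simp add: sum.distrib sum_distrib_left)
      also have "\<dots> < e / 2 + e / 2"
      proof (rule add_less_le_mono)
        show "M2 * (\<Sum>i<n. norm (f (B i) - f (A i))) < e / 2"
          using 1 M by (simp add: field_simps)
        have "L * M1 * (\<Sum>i<n. B i - A i) \<le> (L + 1) * M1 * (e / (2 * M1 * (L + 1)))"
          using * L M by (intro mult_mono) (auto simp: d'_def intro!: sum_nonneg)
        also have "\<dots> = e / 2"
        proof -
          have "L + 1 \<noteq> 0" "M1 \<noteq> 0" using M L by auto
          then show ?thesis by (simp add: divide_simps)
        qed
        finally show "L * M1 * (\<Sum>i<n. B i - A i) \<le> e / 2" .
      qed
      finally show "(\<Sum>i<n. norm (k (B i) *\<^sub>R f (B i) - k (A i) *\<^sub>R f (A i))) < e" by simp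
    qed
  qed
qed

text \<open>Henstock's argument: at points of differentiability the gauge controls the difference
  quotient, and over the null set the gauge stays inside an open set of small measure, where absolute
  continuity makes the increments of the function small.\<close>

theorem abs_continuous_on_has_integral:
  fixes f :: "real \<Rightarrow> 'a::banach"
  assumes "a \<le> b" and ac: "abs_continuous_on {a..b} f" and N: "negligible N"
    and deriv: "\<And>x. x \<in> {a..b} - N \<Longrightarrow> (f has_vector_derivative f' x) (at x within {a..b})"
  shows "(f' has_integral (f b - f a)) {a..b}"
proof -
  \<comment> \<open>With the value 0 on \<open>N\<close>, tags in the null set contribute nothing to
    a Riemann sum and only the increments of \<open>f\<close> there must be controlled. The last
    step trades \<open>g\<close> for \<open>f'\<close>.\<close>
  define g where "g x = (if x \<in> N then 0 else f' x)" for x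
  have "(g has_integral (f b - f a)) {a..b}"
    unfolding has_integral_real
  proof (intro allI impI)
    fix e :: real assume e: "e > 0"
    \<comment> \<open>Half of \<open>e\<close> is for the tags outside \<open>N\<close>, the other
      half for those in \<open>N\<close>; the summand 1 allows \<open>a = b\<close>.\<close>
    define e' where "e' = e / (2 * (b - a + 1))"
    have e': "e' > 0" using e \<open>a \<le> b\<close> by (simp add: e'_def)
    have "\<forall>x. \<exists>d>0. x \<in> {a..b} - N \<longrightarrow>
         (\<forall>y\<in>{a..b}. norm (y-x) < d \<longrightarrow> norm (f y - f x - (y-x) *\<^sub>R f' x) \<le> e' * norm (y-x))"
      using deriv[unfolded has_vector_derivative_def has_derivative_within_alt] e' by (meson zero_less_one)
    then obtain r where r: "\<And>x. 0 < r x"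
                 "\<And>x y. \<lbrakk>x \<in> {a..b} - N; y \<in> {a..b}; norm (y-x) < r x\<rbrakk>
                        \<Longrightarrow> norm (f y - f x - (y-x) *\<^sub>R f' x) \<le> e' * norm (y-x)"
      by metis
    have "e / 2 > 0" using e by simp
    then obtain d where d: "d > 0" and acd: "\<forall>(q :: (real \<times> real set) set) A B. finite q \<and>
       (\<forall>i\<in>q. A i \<in> {a..b} \<and> B i \<in> {a..b} \<and> A i \<le> B i) \<and>
       (\<forall>i\<in>q. \<forall>j\<in>q. i \<noteq> j \<longrightarrow> B i \<le> A j \<or> B j \<le> A i) \<and> (\<Sum>i\<in>q. B i - A i) < d \<longrightarrow>
       (\<Sum>i\<in>q. norm (f (B i) - f (A i))) < e / 2"
      using abs_continuous_on_finite_sets[OF ac, of "e/2", where ?'i = "real \<times> real set"] by blast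
    obtain U where U: "open U" "N \<subseteq> U" "emeasure lebesgue U < ennreal d"
    proof -
      have N0: "N \<in> null_sets lebesgue" using N by (simp add: negligible_iff_null_sets)
      then obtain T where T: "open T" "N \<subseteq> T" "emeasure lebesgue (T - N) < ennreal d"
        using sets_lebesgue_outer_open[OF null_setsD2[OF N0] d] by metis
      have "emeasure lebesgue (T - N) = emeasure lebesgue T"
        using N0 T by (intro emeasure_Diff_null_set) auto
      then show ?thesis using T(3) by (intro that[OF T(1,2)]) simp
    qed
    define \<gamma> where "\<gamma> x = (if x \<in> N then U else ball x (r x))" for x
    have gauge: "gauge \<gamma>" using U r by (auto simp: gauge_def \<gamma>_def)
    have approx: "norm ((\<Sum>(x,k)\<in>p. measure lborel k *\<^sub>R g x) - (f b - f a)) < e"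
      if p: "p tagged_division_of {a..b}" and fine: "\<gamma> fine p" for p
    proof -
      have fin: "finite p" using p by blast
      have ba: "b - a = (\<Sum>(x,K)\<in>p. Sup K - Inf K)" "f b - f a = (\<Sum>(x,K)\<in>p. f(Sup K) - f(Inf K))"
        using additive_tagged_division_1[where f= "\<lambda>x. x"] additive_tagged_division_1[where f= f]
            \<open>a \<le> b\<close> p by auto
      have K: "\<exists>u v. K = {u..v} \<and> u \<le> v \<and> Inf K = u \<and> Sup K = v \<and> measure lborel K = v - u \<and>
          u \<in> {a..b} \<and> v \<in> {a..b} \<and> u \<le> x \<and> x \<le> v \<and> x \<in> {a..b}"
        if xK: "(x, K) \<in> p" for x K
      proof -
        have 1: "x \<in> K" "K \<subseteq> {a..b}" using p xK by blast+
        obtain u v where 2: "K = {u..v}" using p xK by (metis box_real(2) tagged_division_ofD(4))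
        show ?thesis using 1 2 by (intro exI[of _ u] exI[of _ v]) auto
      qed
      \<comment> \<open>Degenerate intervals are dropped: their increments vanish, and a single
        point may lie inside another interval of the division, so disjoint interiors would not put
        the intervals in order.\<close>
      define q where "q = {(x,K)\<in>p. x \<in> N \<and> Inf K < Sup K}"
      have qp: "q \<subseteq> p" by (auto simp: q_def)
      have finq: "finite q" using fin qp finite_subset by blast
      have disj: "Sup K \<le> Inf K' \<or> Sup K' \<le> Inf K"
        if "(x, K) \<in> q" "(x', K') \<in> q" "(x, K) \<noteq> (x', K')" for x K x' K'
      proof -
        have "interior K \<inter> interior K' = {}"
          using p that qp by (meson subsetD tagged_division_ofD(5))
        moreover have "(x, K) \<in> p" "Inf K < Sup K" "(x', K') \<in> p" "Inf K' < Sup K'"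
          using that by (auto simp: q_def)
        moreover obtain u v where "K = {u..v}" "Inf K = u" "Sup K = v" "u < v"
          using K[OF \<open>(x, K) \<in> p\<close>] \<open>Inf K < Sup K\<close> by metis
        moreover obtain u' v' where "K' = {u'..v'}" "Inf K' = u'" "Sup K' = v'" "u' < v'"
          using K[OF \<open>(x', K') \<in> p\<close>] \<open>Inf K' < Sup K'\<close> by metis
        ultimately have "{u<..<v} \<inter> {u'<..<v'} = {}" by auto
        then have "v \<le> u' \<or> v' \<le> u"
          using \<open>u < v\<close> \<open>u' < v'\<close> by (simp add: Int_greaterThanLessThan) linarith
        then show ?thesis using \<open>Inf K = u\<close> \<open>Sup K = v\<close> \<open>Inf K' = u'\<close> \<open>Sup K' = v'\<close> by auto
      qed
      have "(\<Sum>i\<in>q. norm (f (Sup (snd i)) - f (Inf (snd i)))) < e / 2"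
      proof (rule acd[THEN spec, THEN spec, THEN spec, THEN mp], intro conjI finq ballI impI)
        show "Inf (snd i) \<in> {a..b}" "Sup (snd i) \<in> {a..b}" "Inf (snd i) \<le> Sup (snd i)" if "i \<in> q" for i
          using K[of "fst i" "snd i"] that qp by auto
        show "Sup (snd i) \<le> Inf (snd j) \<or> Sup (snd j) \<le> Inf (snd i)" if "i \<in> q" "j \<in> q" "i \<noteq> j" for i j
          using disj[of "fst i" "snd i" "fst j" "snd j"] that by auto
        \<comment> \<open>The total length is computed as the measure of a disjoint union of open
          intervals, which lies in \<open>U\<close> because the division is fine.\<close>
        let ?I = "\<lambda>i::real \<times> real set. {Inf (snd i)<..<Sup (snd i)}"
        have "disjoint_family_on ?I q"
          unfolding disjoint_family_on_def using disj by fastforce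
        then have "(\<Sum>i\<in>q. emeasure lebesgue (?I i)) = emeasure lebesgue (\<Union>i\<in>q. ?I i)"
          using finq by (intro sum_emeasure) auto
        also have "\<dots> \<le> emeasure lebesgue U"
        proof (rule emeasure_mono)
          have "?I i \<subseteq> U" if "i \<in> q" for i
          proof -
            have "snd i \<subseteq> U" using fine that qp by (fastforce simp: fine_def q_def \<gamma>_def)
            moreover have "(fst i, snd i) \<in> p" using that qp by auto
            then obtain u v where "snd i = {u..v}" "Inf (snd i) = u" "Sup (snd i) = v"
              using K by metis
            ultimately show ?thesis by auto
          qed
          then show "(\<Union>i\<in>q. ?I i) \<subseteq> U" by blast
        qed (use U in auto)
        also have "\<dots> < ennreal d" by (rule U)
        also have "(\<Sum>i\<in>q. emeasure lebesgue (?I i)) = (\<Sum>i\<in>q. ennreal (Sup (snd i) - Inf (snd i)))"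
          by (intro sum.cong refl) (auto simp: q_def)
        also have "\<dots> = ennreal (\<Sum>i\<in>q. Sup (snd i) - Inf (snd i))"
          by (intro sum_ennreal) (auto simp: q_def)
        finally show "(\<Sum>i\<in>q. Sup (snd i) - Inf (snd i)) < d"
          by (subst (asm) ennreal_less_iff) (auto simp: q_def intro!: sum_nonneg)
      qed
      have bound: "norm (measure lborel K *\<^sub>R g x - (f (Sup K) - f (Inf K))) \<le>
          e' * (Sup K - Inf K) + (if (x, K) \<in> q then norm (f (Sup K) - f (Inf K)) else 0)"
        if xK: "(x, K) \<in> p" for x K
      proof -
        obtain u v where uv: "K = {u..v}" "u \<le> v" "Inf K = u" "Sup K = v" "measure lborel K = v - u"
            "u \<in> {a..b}" "v \<in> {a..b}" "u \<le> x" "x \<le> v" "x \<in> {a..b}" using K[OF xK] by blast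
        show ?thesis
        proof (cases "x \<in> N")
          case True
          then show ?thesis using xK e' uv by (cases "u = v") (auto simp: q_def g_def norm_minus_commute)
        next
          case False
          have sub: "{u..v} \<subseteq> ball x (r x)"
            using fine xK False uv by (fastforce simp: fine_def \<gamma>_def)
          have "u \<in> {u..v}" "v \<in> {u..v}" using uv(2) by auto
          then have "u \<in> ball x (r x)" "v \<in> ball x (r x)" using sub by blast+
          then have uvr: "norm (u - x) < r x" "norm (v - x) < r x" by (auto simp: dist_real_def)
          \<comment> \<open>The increment is split at the tag; since u \<le> x \<le> v, the two
            errors add up to \<open>e'\<close> times the full length v - u.\<close>
          have "(v - u) *\<^sub>R f' x - (f v - f u) =
              (f u - f x - (u - x) *\<^sub>R f' x) - (f v - f x - (v - x) *\<^sub>R f' x)"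
            by (simp add: algebra_simps)
          also have "norm \<dots> \<le> norm (f u - f x - (u - x) *\<^sub>R f' x) + norm (f v - f x - (v - x) *\<^sub>R f' x)"
            by (rule norm_triangle_ineq4)
          also have "\<dots> \<le> e' * norm (u - x) + e' * norm (v - x)"
            using r(2)[of x u] r(2)[of x v] uv uvr False by (intro add_mono) simp_all
          also have "\<dots> = e' * (v - u)" using uv by (simp add: algebra_simps)
          finally show ?thesis using False uv by (auto simp: g_def q_def)
        qed
      qed
      have "norm ((\<Sum>(x,k)\<in>p. measure lborel k *\<^sub>R g x) - (f b - f a)) =
          norm (\<Sum>i\<in>p. measure lborel (snd i) *\<^sub>R g (fst i) - (f (Sup (snd i)) - f (Inf (snd i))))"
        by (simp add: ba split_def sum_subtractf)
      also have "\<dots> \<le> (\<Sum>i\<in>p. e' * (Sup (snd i) - Inf (snd i)) +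
          (if i \<in> q then norm (f (Sup (snd i)) - f (Inf (snd i))) else 0))"
      proof (rule sum_norm_le)
        fix i assume "i \<in> p"
        then show "norm (measure lborel (snd i) *\<^sub>R g (fst i) - (f (Sup (snd i)) - f (Inf (snd i)))) \<le>
            e' * (Sup (snd i) - Inf (snd i)) + (if i \<in> q then norm (f (Sup (snd i)) - f (Inf (snd i))) else 0)"
          using bound[of "fst i" "snd i"] by (simp only: prod.collapse)
      qed
      also have "\<dots> = (\<Sum>i\<in>p. e' * (Sup (snd i) - Inf (snd i))) +
          (\<Sum>i\<in>p. if i \<in> q then norm (f (Sup (snd i)) - f (Inf (snd i))) else 0)"
        by (rule sum.distrib)
      also have "(\<Sum>i\<in>p. e' * (Sup (snd i) - Inf (snd i))) = e' * (b - a)"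
        by (simp only: ba(1) sum_distrib_left split_def)
      also have "(\<Sum>i\<in>p. if i \<in> q then norm (f (Sup (snd i)) - f (Inf (snd i))) else 0) =
          (\<Sum>i\<in>q. norm (f (Sup (snd i)) - f (Inf (snd i))))"
        using sum.inter_restrict[OF fin, of "\<lambda>i. norm (f (Sup (snd i)) - f (Inf (snd i)))" q]
        by (simp only: Int_absorb1[OF qp])
      also have "e' * (b - a) + (\<Sum>i\<in>q. norm (f (Sup (snd i)) - f (Inf (snd i)))) < e / 2 + e / 2"
      proof (rule add_le_less_mono)
        show "e' * (b - a) \<le> e / 2" using \<open>a \<le> b\<close> e by (simp add: e'_def field_simps)
      qed fact
      finally show ?thesis by simp
    qed
    show "\<exists>\<gamma>. gauge \<gamma> \<and> (\<forall>\<D>. \<D> tagged_division_of {a..b} \<and> \<gamma> fine \<D> \<longrightarrow>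
        norm ((\<Sum>(x,k)\<in>\<D>. measure lborel k *\<^sub>R g x) - (f b - f a)) < e)"
      by (intro exI[of _ \<gamma>] conjI allI impI gauge approx) auto
  qed
  moreover have "f' x = g x" if "x \<in> {a..b} - N" for x using that by (simp add: g_def)
  ultimately show ?thesis using has_integral_spike[OF N, of "{a..b}" f' g] by blast
qed

subsection \<open>Area measure on the disc\<close>

lemma measurable_Complex [measurable (raw)]:
  assumes "f \<in> borel_measurable M" "g \<in> borel_measurable M"
  shows "(\<lambda>x. Complex (f x) (g x)) \<in> borel_measurable M"
  unfolding Complex_eq using assms by measurable

text \<open>Lebesgue measure is determined by the volumes of boxes, and a complex box pulls back to
  the real box with the same coordinates. This makes Tonelli's theorem in the two coordinates
  available for area integrals.\<close>

lemma lborel_complex_eq_distr: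
  "lborel = distr (lborel :: (real \<times> real) measure) borel (\<lambda>(x, y). Complex x y)"
proof (rule lborel_eqI)
  have [measurable]: "(\<lambda>(x, y). Complex x y) \<in> borel_measurable (borel :: (real \<times> real) measure)"
    by (simp add: case_prod_unfold borel_prod[symmetric])
  fix l u :: complex assume lu: "\<And>b. b \<in> Basis \<Longrightarrow> l \<bullet> b \<le> u \<bullet> b"
  have "(\<lambda>(x, y). Complex x y) -` box l u = box (Re l, Im l) (Re u, Im u)"
    by (auto simp: box_def Basis_complex_def Basis_prod_def inner_complex_def)
  then have "emeasure (distr lborel borel (\<lambda>(x, y). Complex x y)) (box l u) = emeasure lborel (box (Re l, Im l) (Re u, Im u))"
    by (subst emeasure_distr) (auto simp: space_lborel)
  also have "\<dots> = ennreal (\<Prod>b\<in>Basis. (u - l) \<bullet> b)"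
    using lu[of 1] lu[of \<i>] by (subst emeasure_lborel_box) (auto simp: Basis_complex_def Basis_prod_def inner_complex_def mult.commute)
  finally show "emeasure (distr lborel borel (\<lambda>(x, y). Complex x y)) (box l u) = (\<Prod>b\<in>Basis. (u - l) \<bullet> b)" .
qed simp

lemma nn_integral_complex:
  assumes [measurable]: "f \<in> borel_measurable borel"
  shows "(\<integral>\<^sup>+z. f z \<partial>lborel) = (\<integral>\<^sup>+y. \<integral>\<^sup>+x. f (Complex x y) \<partial>lborel \<partial>lborel)"
    and "(\<integral>\<^sup>+z. f z \<partial>lborel) = (\<integral>\<^sup>+x. \<integral>\<^sup>+y. f (Complex x y) \<partial>lborel \<partial>lborel)"
proof -
  have "(\<integral>\<^sup>+z. f z \<partial>lborel) = (\<integral>\<^sup>+(x, y). f (Complex x y) \<partial>(lborel \<Otimes>\<^sub>M lborel))"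
    by (subst lborel_complex_eq_distr, subst nn_integral_distr) (auto simp: lborel_prod case_prod_unfold borel_prod[symmetric])
  then show "(\<integral>\<^sup>+z. f z \<partial>lborel) = (\<integral>\<^sup>+y. \<integral>\<^sup>+x. f (Complex x y) \<partial>lborel \<partial>lborel)"
    "(\<integral>\<^sup>+z. f z \<partial>lborel) = (\<integral>\<^sup>+x. \<integral>\<^sup>+y. f (Complex x y) \<partial>lborel \<partial>lborel)"
    using lborel_pair.nn_integral_snd[of "\<lambda>(x, y). f (Complex x y)"]
      lborel.nn_integral_fst[of "\<lambda>(x, y). f (Complex x y)" lborel] by simp_all
qed

text \<open>With the moving coordinate integrated innermost, a shear is a translation of the line
  for each fixed value of the other coordinate.\<close>

lemma nn_integral_shear:
  assumes f [measurable]: "f \<in> borel_measurable borel"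
  shows "(\<integral>\<^sup>+z. f (Complex (Re z + a * Im z) (Im z)) \<partial>lborel) = (\<integral>\<^sup>+z. f z \<partial>lborel)"
    and "(\<integral>\<^sup>+z. f (Complex (Re z) (Im z + a * Re z)) \<partial>lborel) = (\<integral>\<^sup>+z. f z \<partial>lborel)"
proof -
  have "(\<integral>\<^sup>+x. f (Complex (x + a * y) y) \<partial>lborel) = (\<integral>\<^sup>+x. f (Complex x y) \<partial>lborel)" for y
    by (subst nn_integral_real_affine[of "\<lambda>x. f (Complex x y)" 1 "a * y"]) (auto simp: add.commute)
  then show "(\<integral>\<^sup>+z. f (Complex (Re z + a * Im z) (Im z)) \<partial>lborel) = (\<integral>\<^sup>+z. f z \<partial>lborel)"
    by (subst (1 2) nn_integral_complex(1)) simp_all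
  have "(\<integral>\<^sup>+y. f (Complex x (y + a * x)) \<partial>lborel) = (\<integral>\<^sup>+y. f (Complex x y) \<partial>lborel)" for x
    by (subst nn_integral_real_affine[of "\<lambda>y. f (Complex x y)" 1 "a * x"]) (auto simp: add.commute)
  then show "(\<integral>\<^sup>+z. f (Complex (Re z) (Im z + a * Re z)) \<partial>lborel) = (\<integral>\<^sup>+z. f z \<partial>lborel)"
    by (subst (1 2) nn_integral_complex(2)) simp_all
qed

text \<open>A rotation other than by a half turn is a product of three shears, with
  \<open>a = tan (t / 2)\<close>; the half turn is the square of a quarter turn.\<close>

lemma nn_integral_rotate:
  assumes f [measurable]: "f \<in> borel_measurable borel"
  shows "(\<integral>\<^sup>+z. f (z * cis t) \<partial>lborel) = (\<integral>\<^sup>+z. f z \<partial>lborel)"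
proof -
  have rot: "(\<integral>\<^sup>+z. f (z * cis t) \<partial>lborel) = (\<integral>\<^sup>+z. f z \<partial>lborel)"
    if [measurable]: "f \<in> borel_measurable borel" and t: "cos t \<noteq> -1" for f :: "complex \<Rightarrow> ennreal" and t
  proof -
    \<comment> \<open>This is -tan(t/2) without half angles, finite because cos t is not -1. The
      composition is: horizontal shear by \<open>a\<close>, vertical shear by \<open>sin t\<close>,
      horizontal shear by \<open>a\<close>; the identities \<open>as\<close> and \<open>a2\<close>
      reduce its entries to those of the rotation.\<close>
    define a where "a = - sin t / (1 + cos t)"
    have nz: "1 + cos t \<noteq> 0" using t by (simp add: add_eq_0_iff)
    have s2: "sin t * sin t = (1 + cos t) * (1 - cos t)"
      using sin_squared_eq[of t] by (simp add: power2_eq_square algebra_simps)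
    have as: "a * sin t = cos t - 1" 
      using nz s2 by (simp add: a_def divide_simps)
    have a2: "a * (1 + cos t) = - sin t" using nz by (simp add: a_def)
    let ?g = "\<lambda>z. f (Complex (Re z + a * Im z) (Im z))"
    let ?h = "\<lambda>z. ?g (Complex (Re z) (Im z + sin t * Re z))"
    have "f (z * cis t) = ?h (Complex (Re z + a * Im z) (Im z))" for z
    proof -
      have "Im z + sin t * (Re z + a * Im z) = Re z * sin t + Im z * (1 + a * sin t)"
        by (simp add: algebra_simps)
      then have 2: "Im z + sin t * (Re z + a * Im z) = Re z * sin t + Im z * cos t"
        using as by simp
      have "Re z + a * Im z + a * (Re z * sin t + Im z * cos t) = Re z * (1 + a * sin t) + Im z * (a * (1 + cos t))"
        by (simp add: algebra_simps)
      then have 3: "Re z + a * Im z + a * (Re z * sin t + Im z * cos t) = Re z * cos t - Im z * sin t"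
        using as a2 by simp
      have "z * cis t = Complex (Re z * cos t - Im z * sin t) (Re z * sin t + Im z * cos t)"
        by (simp add: complex_eq_iff)
      then show ?thesis using 2 3 by simp
    qed
    then have "(\<integral>\<^sup>+z. f (z * cis t) \<partial>lborel) = (\<integral>\<^sup>+z. ?h (Complex (Re z + a * Im z) (Im z)) \<partial>lborel)"
      by presburger
    also have "\<dots> = (\<integral>\<^sup>+z. ?h z \<partial>lborel)" by (rule nn_integral_shear) simp
    also have "\<dots> = (\<integral>\<^sup>+z. ?g z \<partial>lborel)" by (rule nn_integral_shear) simp
    also have "\<dots> = (\<integral>\<^sup>+z. f z \<partial>lborel)" by (rule nn_integral_shear) simp
    finally show ?thesis .
  qed
  show ?thesis
  proof (cases "cos t = -1")
    case True
    then have "cos (t / 2) \<noteq> -1" using cos_double_cos[of "t/2"] by auto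
    moreover have "cis t = cis (t / 2) * cis (t / 2)" by (simp add: cis_mult)
    ultimately show ?thesis
      using rot[of "\<lambda>z. f (z * cis (t/2))" "t/2"] rot[of f "t/2"] by (simp add: mult.assoc)
  qed (simp add: rot)
qed

text \<open>The radial half of polar coordinates. Both measures give a half-line below
  \<open>a\<close> the area of the disc whose radius is \<open>a\<close> clamped to [0,1], and
  half-lines form an intersection-stable generator of the Borel sets.\<close>

lemma distr_cmod_lborel:
  "distr (restrict_space lborel (ball 0 1)) borel cmod
    = density lborel (\<lambda>r. ennreal (2 * pi * r) * indicator {0<..<1} r)" (is "?M = ?N")
proof (rule measure_eqI_generator_eq[where E = "range (\<lambda>a::real. {..<a})" and \<Omega> = UNIV and A = "\<lambda>i. {..<real i}"])
  have M: "emeasure ?M {..<a} = ennreal (pi * (max 0 (min a 1))\<^sup>2)" for a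
  proof -
    have "emeasure ?M {..<a} = emeasure (restrict_space lborel (ball 0 1)) (cmod -` {..<a} \<inter> ball 0 1)"
      by (subst emeasure_distr) (auto simp: space_restrict_space intro!: measurable_restrict_space1)
    also have "\<dots> = emeasure lborel (ball (0::complex) (max 0 (min a 1)))"
      by (subst emeasure_restrict_space) (auto intro!: arg_cong2[where f = emeasure] simp: less_max_iff_disj not_le[symmetric])
    also have "\<dots> = ennreal (pi * (max 0 (min a 1))\<^sup>2)"
      by (subst emeasure_ball) (auto simp: unit_ball_vol_2)
    finally show ?thesis .
  qed
  have N: "emeasure ?N {..<a} = ennreal (pi * (max 0 (min a 1))\<^sup>2)" for a
  proof -
    have "emeasure ?N {..<a} = (\<integral>\<^sup>+r. ennreal (2 * pi * r) * indicator {0<..<1} r * indicator {..<a} r \<partial>lborel)"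
      by (subst emeasure_density) auto
    also have "\<dots> = (\<integral>\<^sup>+r. ennreal (2 * pi * r) * indicator {0..max 0 (min a 1)} r \<partial>lborel)"
    proof (rule nn_integral_cong_AE)
      \<comment> \<open>Changing two points gives the closed interval on which the fundamental
        theorem is stated.\<close>
      have "AE r in lborel. r \<noteq> 0 \<and> r \<noteq> max 0 (min a (1::real))"
        using AE_lborel_singleton by auto
      then show "AE r in lborel. ennreal (2 * pi * r) * indicator {0<..<1} r * indicator {..<a} r =
          ennreal (2 * pi * r) * indicator {0..max 0 (min a 1)} r"
        by eventually_elim (auto simp: indicator_def)
    qed
    also have "\<dots> = ennreal (pi * (max 0 (min a 1))\<^sup>2 - pi * 0\<^sup>2)"
      by (rule nn_integral_FTC_Icc[where F = "\<lambda>r. pi * r\<^sup>2"]) (auto intro!: derivative_eq_intros)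
    finally show ?thesis by simp
  qed
  show "emeasure ?M X = emeasure ?N X" if "X \<in> range (\<lambda>a::real. {..<a})" for X
    using that M N by auto
  show "Int_stable (range (\<lambda>a::real. {..<a}))"
  proof (rule Int_stableI_image)
    show "\<exists>c\<in>UNIV. {..<a} \<inter> {..<b} = {..<c}" for a b :: real
      by (rule bexI[of _ "min a b"]) auto
  qed
  show "sets ?M = sigma_sets UNIV (range (\<lambda>a::real. {..<a}))" "sets ?N = sigma_sets UNIV (range (\<lambda>a::real. {..<a}))"
    by (simp_all add: borel_Iio)
  show "(\<Union>i. {..<real i}) = UNIV" using reals_Archimedean2 by auto
  show "emeasure ?M {..<real i} \<noteq> \<infinity>" for i by (simp add: M)
qed auto

lemma nn_integral_cmod_disc:
  fixes g :: "real \<Rightarrow> ennreal"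
  assumes [measurable]: "g \<in> borel_measurable borel"
  shows "(\<integral>\<^sup>+z. g (cmod z) * indicator (ball 0 1) z \<partial>lborel) =
    (\<integral>\<^sup>+r. ennreal (2 * pi * r) * g r * indicator {0<..<1} r \<partial>lborel)"
proof -
  have "(\<integral>\<^sup>+z. g (cmod z) * indicator (ball 0 1) z \<partial>lborel) = (\<integral>\<^sup>+z. g (cmod z) \<partial>restrict_space lborel (ball 0 1))"
    by (subst nn_integral_restrict_space) auto
  also have "\<dots> = (\<integral>\<^sup>+r. g r \<partial>distr (restrict_space lborel (ball 0 1)) borel cmod)"
    by (subst nn_integral_distr) (auto intro!: measurable_restrict_space1)
  also have "\<dots> = (\<integral>\<^sup>+r. ennreal (2 * pi * r) * indicator {0<..<1} r * g r \<partial>lborel)"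
    unfolding distr_cmod_lborel by (subst nn_integral_density) auto
  finally show ?thesis by (simp add: mult_ac)
qed

subsection \<open>The constant C(p)\<close>

lemma artanh_real_nonneg: "0 \<le> r \<Longrightarrow> r < 1 \<Longrightarrow> 0 \<le> artanh (r::real)"
  by (simp add: artanh_def)

text \<open>This is ln (1 + x) \<le> x at x = 2 r / (1 - r).\<close>

lemma artanh_over_self_le:
  assumes "0 < r" "r < (1::real)"
  shows "artanh r / r \<le> 1 / (1 - r)"
proof -
  have "(1 + r) / (1 - r) = 1 + 2 * r / (1 - r)" using assms by (simp add: field_simps)
  then have "artanh r \<le> r / (1 - r)"
    using ln_add_one_self_le_self[of "2 * r / (1 - r)"] assms by (simp add: artanh_def mult.commute)
  then show ?thesis using assms by (simp add: field_simps)
qed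

text \<open>An integrable majorant that yields C(p) < \<infinity>. Up to r = 1/2 the quotient artanh
  r / r is at most 2, which gives the first constant; beyond it the logarithmic singularity at 1 is
  dominated by (1 - r)^(-1/2), which gives the second.\<close>

lemma artanh_kernel_bound:
  assumes p: "1 \<le> p" and r: "0 < r" "r < 1"
  shows "(4 * artanh r / (pi * r)) powr p * r \<le> ((8 / pi) powr p + (8 * p / pi) powr p * sqrt 2) * (1 / sqrt (1 - r))"
proof -
  have nn: "0 \<le> artanh r / r" using r artanh_real_nonneg[of r] by simp
  have nn': "0 \<le> 4 / pi * (artanh r / r)" by (intro mult_nonneg_nonneg nn) simp
  have s: "1 \<le> 1 / sqrt (1 - r)" using r by simp
  have "(4 * artanh r / (pi * r)) powr p * r \<le> (4 * artanh r / (pi * r)) powr p"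
    using r by (simp add: mult_left_le)
  also have "\<dots> = (4 / pi * (artanh r / r)) powr p" by simp
  also have "\<dots> \<le> ((8 / pi) powr p + (8 * p / pi) powr p * sqrt 2) * (1 / sqrt (1 - r))"
  proof (cases "r \<le> 1 / 2")
    case True
    have "artanh r / r \<le> 1 / (1 - r)" by (rule artanh_over_self_le[OF r])
    also have "\<dots> \<le> 2" using True by (simp add: field_simps)
    finally have "4 / pi * (artanh r / r) \<le> 8 / pi"
      using mult_left_mono[of "artanh r / r" 2 "4 / pi"] by simp
    then have "(4 / pi * (artanh r / r)) powr p \<le> (8 / pi) powr p"
      using nn' p by (intro powr_mono2) auto
    also have "\<dots> \<le> (8 / pi) powr p + (8 * p / pi) powr p * sqrt 2" by simp
    also have "\<dots> \<le> \<dots> * (1 / sqrt (1 - r))"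
      using s by (metis add_nonneg_nonneg mult_left_le mult_left_mono mult.right_neutral mult_nonneg_nonneg powr_ge_zero real_sqrt_ge_zero zero_le_numeral)
    finally show ?thesis .
  next
    case False
    \<comment> \<open>Here artanh r = ln y / 2, so artanh r / r \<le> ln y once 2 r > 1.\<close>
    define y where "y = (1 + r) / (1 - r)"
    have y: "1 < y" "y \<le> 2 / (1 - r)" using r by (auto simp: y_def less_divide_eq intro!: divide_right_mono)
    have "artanh r / r \<le> ln y" using False r y by (simp add: artanh_def y_def field_simps)
    then have "4 / pi * (artanh r / r) \<le> 4 / pi * ln y" by (intro mult_left_mono) auto
    then have "(4 / pi * (artanh r / r)) powr p \<le> (4 / pi * ln y) powr p"
      using nn' p by (intro powr_mono2) auto
    also have "\<dots> = (4 / pi) powr p * (ln y powr p)"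
      using y by (subst powr_mult) auto
    \<comment> \<open>Doubling the exponent before the bound of a power of ln y by a multiple of y
      leaves only sqrt y, hence the integrable singularity (1 - r)^(-1/2).\<close>
    also have "ln y powr p = sqrt (ln y powr (2 * p))"
      using y by (simp add: powr_half_sqrt[symmetric] powr_powr)
    also have "\<dots> \<le> sqrt ((2 * p) powr (2 * p) * (2 / (1 - r)))"
    proof -
      have "ln y powr (2 * p) \<le> (2 * p) powr (2 * p) * y" using ln_powr_bound2[of y "2 * p"] y p by simp
      also have "\<dots> \<le> (2 * p) powr (2 * p) * (2 / (1 - r))" using y by (intro mult_left_mono) auto
      finally show ?thesis by simp
    qed
    also have "\<dots> = (2 * p) powr p * (sqrt 2 * (1 / sqrt (1 - r)))"
    proof -
      have "sqrt ((2 * p) powr (2 * p)) = (2 * p) powr p"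
        using p by (simp add: powr_half_sqrt[symmetric] powr_powr)
      then show ?thesis by (simp add: real_sqrt_mult real_sqrt_divide)
    qed
    also have "(4 / pi) powr p * ((2 * p) powr p * (sqrt 2 * (1 / sqrt (1 - r))))
       = (8 * p / pi) powr p * sqrt 2 * (1 / sqrt (1 - r))"
      using p powr_mult[of "4 / pi" "2 * p" p] by simp
    also have "\<dots> \<le> ((8 / pi) powr p + (8 * p / pi) powr p * sqrt 2) * (1 / sqrt (1 - r))"
      using r by (intro mult_right_mono) auto
    finally show ?thesis by (simp add: mult_left_mono)
  qed
  finally show ?thesis .
qed

text \<open>The primitive -2 sqrt (1 - r) has finite limits at both ends, and the integrand is
  nonnegative.\<close>

lemma set_integrable_inverse_sqrt_one_minus: "set_integrable lborel {0<..<1} (\<lambda>r::real. 1 / sqrt (1 - r))"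
proof -
  have "set_integrable lborel (einterval 0 1) (\<lambda>r::real. 1 / sqrt (1 - r))"
  proof (rule interval_integral_FTC_nonneg(1))
    show "((\<lambda>r. - 2 * sqrt (1 - r)) has_real_derivative 1 / sqrt (1 - x)) (at x)" if "0 < ereal x" "ereal x < 1" for x
      using that by (auto intro!: derivative_eq_intros simp: field_simps)
    show "isCont (\<lambda>r. 1 / sqrt (1 - r)) x" if "0 < ereal x" "ereal x < 1" for x
      using that by (auto intro!: continuous_intros)
    have "((\<lambda>r::real. - 2 * sqrt (1 - r)) \<longlongrightarrow> - 2) (at_right 0)" by (auto intro!: tendsto_eq_intros)
    then show "(((\<lambda>r. - 2 * sqrt (1 - r)) \<circ> real_of_ereal) \<longlongrightarrow> -2) (at_right 0)"
      unfolding zero_ereal_def ereal_tendsto_simps .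
    have "((\<lambda>r::real. - 2 * sqrt (1 - r)) \<longlongrightarrow> 0) (at_left 1)" by (auto intro!: tendsto_eq_intros)
    then show "(((\<lambda>r. - 2 * sqrt (1 - r)) \<circ> real_of_ereal) \<longlongrightarrow> 0) (at_left 1)"
      unfolding one_ereal_def ereal_tendsto_simps .
  qed auto
  moreover have "einterval 0 1 = {0<..<1::real}" by (auto simp: einterval_iff)
  ultimately show ?thesis by simp
qed

lemma borel_measurable_artanh [measurable]: "(artanh :: real \<Rightarrow> real) \<in> borel_measurable borel"
  unfolding artanh_def by measurable

lemma set_integrable_artanh_powr:
  assumes "1 \<le> p"
  shows "set_integrable lborel {0<..<1} (\<lambda>r::real. (4 * artanh r / (pi * r)) powr p * r)"
  unfolding set_integrable_def
proof (rule Bochner_Integration.integrable_bound)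
  show "integrable lborel (\<lambda>r. ((8 / pi) powr p + (8 * p / pi) powr p * sqrt 2) *\<^sub>R (indicator {0<..<1} r *\<^sub>R (1 / sqrt (1 - r))))"
    using set_integrable_inverse_sqrt_one_minus unfolding set_integrable_def by (intro integrable_scaleR_right) auto
  show "AE r in lborel. norm (indicator {0<..<1} r *\<^sub>R ((4 * artanh r / (pi * r)) powr p * r)) \<le>
     norm (((8 / pi) powr p + (8 * p / pi) powr p * sqrt 2) *\<^sub>R (indicator {0<..<1} r *\<^sub>R (1 / sqrt (1 - r))))"
    using artanh_kernel_bound[OF assms] by (auto simp: indicator_def intro!: AE_I2)
qed measurable

text \<open>The overhang beyond \<open>T\<close> is shifted back by one period; a negative
  \<open>a\<close> is first replaced by \<open>a + T\<close>. The range of \<open>a\<close> suffices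
  for shifts by an argument of a complex number.\<close>

lemma integral_periodic:
  fixes f :: "real \<Rightarrow> real"
  assumes cont: "continuous_on UNIV f" and per: "\<And>x. f (x + T) = f x" and "0 < T" "\<bar>a\<bar> \<le> T"
  shows "integral {a..a+T} f = integral {0..T} f"
proof -
  have int: "f integrable_on {x..y}" for x y
    by (intro integrable_continuous_real continuous_on_subset[OF cont]) auto
  have shift: "integral {x+T..y+T} f = integral {x..y} f" for x y
    using integral_shift_real_ivl[of "x+T" T "y+T" f] by (simp add: per)
  have *: "integral {a..a+T} f = integral {0..T} f" if "0 \<le> a" "a \<le> T" for a
  proof -
    have "integral {a..a+T} f = integral {a..T} f + integral {T..a+T} f"
      using that \<open>0 < T\<close> by (intro Henstock_Kurzweil_Integration.integral_combine[symmetric] int) auto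
    also have "integral {T..a+T} f = integral {0..a} f" using shift[of 0 a] by simp
    also have "integral {a..T} f + integral {0..a} f = integral {0..T} f"
      using that Henstock_Kurzweil_Integration.integral_combine[OF _ _ int, of 0 a T] by simp
    finally show ?thesis .
  qed
  show ?thesis
    using *[of a] *[of "a + T"] shift[of a "a+T"] assms by (cases "0 \<le> a") auto
qed

subsection \<open>The conjugate Poisson kernel\<close>

text \<open>The conjugate Poisson kernel, normalised by 1/(2 pi), divided by \<open>r\<close>. The
  division absorbs the factor r in the polar Cauchy-Riemann equation.\<close>

definition conj_kernel :: "real \<Rightarrow> real \<Rightarrow> real" where
  "conj_kernel r s = sin s / (pi * (1 - 2*r*cos s + r^2))"

text \<open>Since r cos s \<le> |r|, the expression is at least (1 - |r|)^2.\<close>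

lemma poisson_denominator_pos:
  fixes r s :: real
  assumes "\<bar>r\<bar> < 1"
  shows "0 < 1 - 2*r*cos s + r^2"
proof -
  have "r * cos s \<le> \<bar>r\<bar> * 1"
    using abs_ge_self[of "r * cos s"] by (simp add: abs_mult) (meson abs_cos_le_one abs_ge_zero mult_left_le order_trans)
  moreover have "0 < (1 - \<bar>r\<bar>)\<^sup>2" using assms by simp
  ultimately show ?thesis by (simp add: power2_eq_square algebra_simps)
qed

definition poisson_kernel_dr :: "real \<Rightarrow> real \<Rightarrow> real" where
  "poisson_kernel_dr r s = ((1 + r^2) * cos s - 2*r) / (pi * (1 - 2*r*cos s + r^2)^2)"

lemma poisson_kernel_has_derivative:
  assumes "\<bar>r\<bar> < 1"
  shows "((\<lambda>r. poisson_kernel r s) has_real_derivative poisson_kernel_dr r s) (at r within S)"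
proof -
  define D where "D = 1 - 2*r*cos s + r^2"
  have D: "D \<noteq> 0" using poisson_denominator_pos[OF assms, of s] by (simp add: D_def)
  have "((\<lambda>r. poisson_kernel r s) has_real_derivative
     ((1 / (2*pi)) * (- (2*r)) * D - (1 / (2*pi)) * (1 - r^2) * (2*r - 2*cos s)) / (D * D)) (at r within S)"
    unfolding poisson_kernel_def D_def
    by (rule derivative_eq_intros refl | use D in \<open>simp add: D_def\<close>)+
  also have "((1 / (2*pi)) * (- (2*r)) * D - (1 / (2*pi)) * (1 - r^2) * (2*r - 2*cos s)) / (D * D)
     = poisson_kernel_dr r s"
  proof -
    have "(- (2*r)) * D - (1 - r^2) * (2*r - 2*cos s) = 2 * ((1 + r^2) * cos s - 2*r)"
      by (simp add: D_def power2_eq_square algebra_simps)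
    then have "(1 / (2*pi)) * (- (2*r)) * D - (1 / (2*pi)) * (1 - r^2) * (2*r - 2*cos s)
       = ((1 + r^2) * cos s - 2*r) / pi"
      by (simp add: divide_simps)
    then show ?thesis
      unfolding poisson_kernel_dr_def D_def[symmetric] by (simp add: power2_eq_square)
  qed
  finally show ?thesis .
qed

text \<open>The Cauchy--Riemann relation: the angular derivative of the conjugate kernel is the radial
  derivative of the Poisson kernel.\<close>

lemma conj_kernel_has_derivative:
  assumes "\<bar>r\<bar> < 1"
  shows "(conj_kernel r has_real_derivative poisson_kernel_dr r s) (at s within S)"
proof -
  define D where "D = 1 - 2*r*cos s + r^2"
  have D: "D \<noteq> 0" using poisson_denominator_pos[OF assms, of s] by (simp add: D_def)
  have "((\<lambda>s. conj_kernel r s) has_real_derivative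
     (cos s * (pi * D) - sin s * (pi * (2*r * sin s))) / ((pi * D) * (pi * D))) (at s within S)"
    unfolding conj_kernel_def D_def
    by (rule derivative_eq_intros refl | use D in \<open>simp add: D_def\<close>)+
  also have "(cos s * (pi * D) - sin s * (pi * (2*r * sin s))) / ((pi * D) * (pi * D)) = poisson_kernel_dr r s"
  proof -
    have "cos s * D - 2 * r * (1 - (cos s)\<^sup>2) = (1 + r^2) * cos s - 2*r"
      by (simp add: D_def power2_eq_square algebra_simps)
    then have "cos s * D - 2 * r * (sin s * sin s) = (1 + r^2) * cos s - 2*r"
      by (simp only: sin_squared_eq flip: power2_eq_square)
    then have "cos s * (pi * D) - sin s * (pi * (2*r * sin s)) = pi * ((1 + r^2) * cos s - 2*r)"
      by (metis (no_types, opaque_lifting) mult.assoc mult.commute right_diff_distrib)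
    then show ?thesis
      unfolding poisson_kernel_dr_def D_def[symmetric] using D by (simp add: power2_eq_square)
  qed
  finally show ?thesis by simp
qed

lemma continuous_on_poisson_kernel_dr:
  fixes f g :: "'a::t2_space \<Rightarrow> real"
  assumes "continuous_on S f" "continuous_on S g" "\<And>x. x \<in> S \<Longrightarrow> \<bar>f x\<bar> < 1"
  shows "continuous_on S (\<lambda>x. poisson_kernel_dr (f x) (g x))"
  unfolding poisson_kernel_dr_def using assms poisson_denominator_pos
  by (auto intro!: continuous_intros simp: less_imp_neq[THEN not_sym])

lemma continuous_on_poisson_kernel:
  fixes f g :: "'a::t2_space \<Rightarrow> real"
  assumes "continuous_on S f" "continuous_on S g" "\<And>x. x \<in> S \<Longrightarrow> \<bar>f x\<bar> < 1"
  shows "continuous_on S (\<lambda>x. poisson_kernel (f x) (g x))"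
  unfolding poisson_kernel_def using assms poisson_denominator_pos
  by (auto intro!: continuous_intros simp: less_imp_neq[THEN not_sym])

lemma continuous_on_conj_kernel:
  fixes f g :: "'a::t2_space \<Rightarrow> real"
  assumes "continuous_on S f" "continuous_on S g" "\<And>x. x \<in> S \<Longrightarrow> \<bar>f x\<bar> < 1"
  shows "continuous_on S (\<lambda>x. conj_kernel (f x) (g x))"
  unfolding conj_kernel_def using assms poisson_denominator_pos
  by (auto intro!: continuous_intros simp: less_imp_neq[THEN not_sym])

lemma sin_nonpos_second_half: "pi \<le> x \<Longrightarrow> x \<le> 2 * pi \<Longrightarrow> sin x \<le> 0"
  using sin_ge_zero[of "x - pi"] by simp

text \<open>The kernel has the sign of sin, and the logarithm of its denominator over 2 pi r is a
  primitive. The denominator is (1 - r)^2 at 0 and (1 + r)^2 at pi, which produces artanh; the half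
  periods contribute equally because \<open>A (2*pi) = A 0\<close>. Periodicity absorbs the
  shift.\<close>

lemma integral_abs_conj_kernel:
  assumes r: "0 < r" "r < 1" and a: "\<bar>a\<bar> \<le> 2 * pi"
  shows "integral {0..2*pi} (\<lambda>t. \<bar>conj_kernel r (t - a)\<bar>) = 4 * artanh r / (pi * r)"
proof -
  let ?f = "\<lambda>s. \<bar>conj_kernel r s\<bar>"
  have D: "0 < 1 - 2*r*cos s + r^2" for s using poisson_denominator_pos r by simp
  have cont: "continuous_on UNIV ?f"
    using r by (auto intro!: continuous_intros continuous_on_conj_kernel)
  define A where "A s = ln (1 - 2*r*cos s + r^2) / (2*pi*r)" for s
  have A: "(A has_vector_derivative conj_kernel r s) (at s within S)" for s S
  proof -
    have "((\<lambda>s. 1 - 2*r*cos s + r^2) has_real_derivative 2*r * sin s) (at s within S)"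
      by (auto intro!: derivative_eq_intros)
    from DERIV_cdivide[OF DERIV_chain'[OF this DERIV_ln_divide[OF D[of s]]], of "2*pi*r"]
    have "(A has_real_derivative (1 / (1 - 2*r*cos s + r^2) * (2*r * sin s)) / (2*pi*r)) (at s within S)"
      by (simp only: A_def[abs_def])
    moreover have "(1 / d * (2*r * sin s)) / (2*pi*r) = sin s / (pi * d)" for d
      using r by (simp add: field_simps)
    ultimately show ?thesis
      by (simp add: has_real_derivative_iff_has_vector_derivative conj_kernel_def)
  qed
  have 1: "A pi - A 0 = 2 * artanh r / (pi * r)"
  proof -
    have "1 - 2*r*cos pi + r^2 = (1 + r)^2" "1 - 2*r*cos 0 + r^2 = (1 - r)^2"
      by (simp_all add: power2_eq_square algebra_simps)
    then have "A pi - A 0 = (2 * ln (1 + r) - 2 * ln (1 - r)) / (2*pi*r)"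
      using r by (simp only: A_def) (simp add: ln_realpow diff_divide_distrib)
    also have "\<dots> = 2 * artanh r / (pi * r)"
      using r by (simp add: artanh_def ln_div field_simps)
    finally show ?thesis .
  qed
  have i1: "(conj_kernel r has_integral (A pi - A 0)) {0..pi}"
    by (rule fundamental_theorem_of_calculus) (auto intro: A)
  have i2: "((\<lambda>s. - conj_kernel r s) has_integral - (A (2*pi) - A pi)) {pi..2*pi}"
    by (rule has_integral_neg, rule fundamental_theorem_of_calculus) (auto intro: A)
  have nonneg: "0 \<le> conj_kernel r s" if "0 \<le> sin s" for s
    unfolding conj_kernel_def using D[of s] that by (intro divide_nonneg_pos) auto
  have nonpos: "conj_kernel r s \<le> 0" if "sin s \<le> 0" for s
    unfolding conj_kernel_def using D[of s] that by (intro divide_nonpos_pos) auto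
  have "(?f has_integral (A pi - A 0)) {0..pi}"
    by (rule has_integral_eq[OF _ i1]) (simp add: nonneg sin_ge_zero)
  moreover have "(?f has_integral - (A (2*pi) - A pi)) {pi..2*pi}"
    by (rule has_integral_eq[OF _ i2]) (simp add: nonpos sin_nonpos_second_half abs_of_nonpos)
  ultimately have "(?f has_integral ((A pi - A 0) + - (A (2*pi) - A pi))) {0..2*pi}"
    by (intro has_integral_combine[of 0 pi "2*pi"]) auto
  moreover have "A (2*pi) = A 0" by (simp add: A_def)
  ultimately have "integral {0..2*pi} ?f = 2 * (A pi - A 0)" by (simp add: integral_unique)
  moreover have "integral {-a..-a+2*pi} ?f = integral {0..2*pi} ?f"
    using a by (intro integral_periodic cont) (auto simp: conj_kernel_def)
  moreover have "integral {0..2*pi} (\<lambda>t. ?f (t - a)) = integral {-a..-a+2*pi} ?f"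
    using integral_shift_real_ivl[of "-a" "-a" "-a+2*pi" ?f] by simp
  ultimately show ?thesis using 1 by simp
qed

text \<open>The r-derivative falls on the kernel alone, so continuity of F permits differentiation
  under the integral. The differentiated kernel is then a t-derivative of \<open>conj_kernel\<close>
  and is moved onto F.\<close>

lemma poisson_polar_has_radial_derivative:
  fixes F :: "complex \<Rightarrow> complex"
  assumes ac: "abs_continuous_on {0..2*pi} (\<lambda>t. F (cis t))"
    and deriv: "AE t in lborel. t \<in> {0..2*pi} \<longrightarrow>
                  ((\<lambda>t. F (cis t)) has_vector_derivative Fdot t) (at t)"
    and int: "set_integrable lborel {0..2*pi} Fdot"
    and r: "0 < r" "r < 1"
  shows "((\<lambda>r. poisson_polar F r \<theta>) has_vector_derivative
     - (LINT t:{0..2*pi}|lborel. conj_kernel r (t - \<theta>) *\<^sub>R Fdot t)) (at r)"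
proof -
  let ?f = "\<lambda>t. F (cis t)"
  have cf: "continuous_on {0..2*pi} ?f" by (rule abs_continuous_on_imp_continuous_on[OF ac])
  have polar: "poisson_polar F s \<theta> = integral {0..2*pi} (\<lambda>t. poisson_kernel s (t - \<theta>) *\<^sub>R ?f t)"
    if "s \<in> {0<..<1}" for s
  proof -
    have "continuous_on {0..2*pi} (\<lambda>t. poisson_kernel s (t - \<theta>) *\<^sub>R ?f t)"
      using that by (intro continuous_intros cf continuous_on_poisson_kernel) auto
    then have "set_integrable lborel {0..2*pi} (\<lambda>t. poisson_kernel s (t - \<theta>) *\<^sub>R ?f t)"
      by (rule borel_integrable_atLeastAtMost')
    from interval_integral_eq_integral[OF _ this] show ?thesis
      by (simp add: poisson_polar_def scaleR_conv_of_real zero_ereal_def)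
  qed
  have "((\<lambda>s. integral (cbox 0 (2*pi)) (\<lambda>t. poisson_kernel s (t - \<theta>) *\<^sub>R ?f t)) has_vector_derivative
     integral (cbox 0 (2*pi)) (\<lambda>t. poisson_kernel_dr r (t - \<theta>) *\<^sub>R ?f t)) (at r within {0<..<1})"
  proof (rule leibniz_rule_vector_derivative)
    show "((\<lambda>x. poisson_kernel x (t - \<theta>) *\<^sub>R ?f t) has_vector_derivative poisson_kernel_dr x (t - \<theta>) *\<^sub>R ?f t)
        (at x within {0<..<1})" if "x \<in> {0<..<1}" for x t
      using that
      by (intro has_vector_derivative_eq_rhs[OF has_vector_derivative_scaleR[OF poisson_kernel_has_derivative has_vector_derivative_const]]) auto
    show "(\<lambda>t. poisson_kernel x (t - \<theta>) *\<^sub>R ?f t) integrable_on cbox 0 (2*pi)" if "x \<in> {0<..<1}" for x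
      using that by (intro integrable_continuous continuous_intros continuous_on_poisson_kernel) (auto simp: cf)
    show "continuous_on ({0<..<1} \<times> cbox 0 (2*pi)) (\<lambda>(x, t). poisson_kernel_dr x (t - \<theta>) *\<^sub>R ?f t)"
      unfolding case_prod_unfold
      by (intro continuous_on_scaleR continuous_on_poisson_kernel_dr continuous_intros
            continuous_on_compose2[OF cf, of _ snd]) auto
  qed (use r in auto)
  then have "((\<lambda>s. integral {0..2*pi} (\<lambda>t. poisson_kernel s (t - \<theta>) *\<^sub>R ?f t)) has_vector_derivative
     integral {0..2*pi} (\<lambda>t. poisson_kernel_dr r (t - \<theta>) *\<^sub>R ?f t)) (at r)"
    using r by (simp add: at_within_open[OF _ open_greaterThanLessThan])
  then have der: "((\<lambda>r. poisson_polar F r \<theta>) has_vector_derivative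
     integral {0..2*pi} (\<lambda>t. poisson_kernel_dr r (t - \<theta>) *\<^sub>R ?f t)) (at r)"
    by (rule has_vector_derivative_transform_within_open[where S = "{0<..<1}"]) (use r polar in auto)

  let ?k = "\<lambda>t. conj_kernel r (t - \<theta>)" and ?k' = "\<lambda>t. poisson_kernel_dr r (t - \<theta>)"
  have k': "(?k has_real_derivative ?k' t) (at t within S)" for t S
    using DERIV_chain'[of "\<lambda>t. t - \<theta>" 1 t S "conj_kernel r"] conj_kernel_has_derivative[of r "t - \<theta>" UNIV] r
    by (force intro!: derivative_eq_intros)
  have ck: "continuous_on {0..2*pi} ?k" "continuous_on {0..2*pi} ?k'"
    using r by (auto intro!: continuous_intros continuous_on_conj_kernel continuous_on_poisson_kernel_dr)
  obtain L where L: "L-lipschitz_on {0..2*pi} ?k"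
  proof -
    obtain C where C: "C > 0" "\<And>t. t \<in> {0..2*pi} \<Longrightarrow> \<bar>?k' t\<bar> \<le> C"
      using compact_imp_bounded[OF compact_continuous_image[OF ck(2) compact_Icc]] by (auto simp: bounded_pos)
    have "C-lipschitz_on {0..2*pi} ?k"
    proof (rule bounded_derivative_imp_lipschitz)
      show "(?k has_derivative (\<lambda>x. x * ?k' t)) (at t within {0..2*pi})" for t
        using k'[of t "{0..2*pi}"] by (simp add: has_field_derivative_def mult.commute[of _ "?k' t"])
      show "onorm (\<lambda>x. x * ?k' t) \<le> C" if "t \<in> {0..2*pi}" for t
        using C(2)[OF that] by (intro onorm_le) (simp add: abs_mult mult.commute[of C] mult_left_mono)
    qed (use C in auto)
    then show ?thesis by (rule that)
  qed
  define Q where "Q t \<longleftrightarrow> (?f has_vector_derivative Fdot t) (at t)" for t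
  obtain N where N: "N \<in> null_sets lborel" "{t \<in> space lborel. \<not> (t \<in> {0..2*pi} \<longrightarrow> Q t)} \<subseteq> N"
    using deriv unfolding Q_def[symmetric] eventually_ae_filter by blast
  have Q: "Q t" if "t \<in> {0..2*pi} - N" for t
    using N(2) that by auto
  have N0: "negligible N" using N(1) by (simp add: negligible_iff_null_sets null_sets_completionI)
  \<comment> \<open>Integration by parts: the fundamental theorem for the absolutely continuous
    product \<open>?k t *\<^sub>R ?f t\<close>.\<close>
  have "((\<lambda>t. ?k t *\<^sub>R Fdot t + ?k' t *\<^sub>R ?f t) has_integral
     ?k (2*pi) *\<^sub>R ?f (2*pi) - ?k 0 *\<^sub>R ?f 0) {0..2*pi}"
  proof (rule abs_continuous_on_has_integral[OF _ abs_continuous_on_scaleR[OF ac L] N0])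
    show "((\<lambda>t. ?k t *\<^sub>R ?f t) has_vector_derivative ?k t *\<^sub>R Fdot t + ?k' t *\<^sub>R ?f t) (at t within {0..2*pi})"
      if "t \<in> {0..2*pi} - N" for t
      by (rule has_vector_derivative_scaleR[OF k' has_vector_derivative_at_within[OF Q[OF that, unfolded Q_def]]])
  qed simp
  \<comment> \<open>The boundary terms cancel: the kernel is 2 pi-periodic, and F takes one value at
    \<open>cis 0 = cis (2*pi)\<close>.\<close>
  also have "?k (2*pi) *\<^sub>R ?f (2*pi) - ?k 0 *\<^sub>R ?f 0 = 0"
    by (simp add: conj_kernel_def sin_diff cos_diff)
  finally have "((\<lambda>t. ?k t *\<^sub>R Fdot t + ?k' t *\<^sub>R ?f t) has_integral 0) {0..2*pi}" .
  moreover have "((\<lambda>t. ?k' t *\<^sub>R ?f t) has_integral integral {0..2*pi} (\<lambda>t. ?k' t *\<^sub>R ?f t)) {0..2*pi}"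
    by (intro integrable_integral integrable_continuous_real continuous_intros ck cf)
  ultimately have "((\<lambda>t. (?k t *\<^sub>R Fdot t + ?k' t *\<^sub>R ?f t) - ?k' t *\<^sub>R ?f t) has_integral
      (0 - integral {0..2*pi} (\<lambda>t. ?k' t *\<^sub>R ?f t))) {0..2*pi}"
    by (rule has_integral_diff)
  then have parts: "((\<lambda>t. ?k t *\<^sub>R Fdot t) has_integral - integral {0..2*pi} (\<lambda>t. ?k' t *\<^sub>R ?f t)) {0..2*pi}"
    by simp
  \<comment> \<open>\<open>parts\<close> is a Henstock-Kurzweil statement; absolute integrability,
    from a bounded kernel and integrable \<open>Fdot\<close>, identifies it with the Lebesgue
    integral.\<close>
  have "set_integrable lborel {0..2*pi} (\<lambda>t. ?k t *\<^sub>R Fdot t)"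
  proof -
    obtain C where C: "C > 0" "\<And>t. t \<in> {0..2*pi} \<Longrightarrow> \<bar>?k t\<bar> \<le> C"
      using compact_imp_bounded[OF compact_continuous_image[OF ck(1) compact_Icc]] by (auto simp: bounded_pos)
    have [measurable]: "(\<lambda>t. indicator {0..2*pi} t *\<^sub>R Fdot t) \<in> borel_measurable lborel"
      using int unfolding set_integrable_def by auto
    have [measurable]: "?k \<in> borel_measurable lborel" unfolding conj_kernel_def by measurable
    have "integrable lborel (\<lambda>t. ?k t *\<^sub>R (indicator {0..2*pi} t *\<^sub>R Fdot t))"
    proof (rule Bochner_Integration.integrable_bound)
      show "integrable lborel (\<lambda>t. C *\<^sub>R (indicator {0..2*pi} t *\<^sub>R Fdot t))"
        using int unfolding set_integrable_def by (intro integrable_scaleR_right) auto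
      show "(\<lambda>t. ?k t *\<^sub>R (indicator {0..2*pi} t *\<^sub>R Fdot t)) \<in> borel_measurable lborel"
        by measurable
    qed (use C in \<open>auto simp: indicator_def intro!: AE_I2 mult_right_mono\<close>)
    then show ?thesis by (simp add: set_integrable_def mult_ac)
  qed
  then have "(LINT t:{0..2*pi}|lborel. ?k t *\<^sub>R Fdot t) = - integral {0..2*pi} (\<lambda>t. ?k' t *\<^sub>R ?f t)"
    using set_borel_integral_eq_integral(2) integral_unique[OF parts] by metis
  with der show ?thesis by simp
qed

subsection \<open>The estimate on the disc\<close>

text \<open>Minus \<open>conj_kernel\<close> as a function of the single point u = z e^{-it}: the
  denominator is |1 - u|^2, and Im u / |u| is minus the sine of t - Arg z. Without
  \<open>Arg\<close>, measurability is immediate and rotation invariance applies directly. The value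
  at 0 is 0 by division by zero.\<close>

definition disc_kernel :: "complex \<Rightarrow> real" where
  "disc_kernel u = Im u / (cmod u * (pi * (cmod (1 - u))\<^sup>2))"

lemma borel_measurable_disc_kernel [measurable]: "disc_kernel \<in> borel_measurable borel"
  unfolding disc_kernel_def[abs_def] by measurable

lemma borel_measurable_cis [measurable]: "cis \<in> borel_measurable borel"
  by (intro borel_measurable_continuous_onI) (auto intro!: continuous_intros)

lemma conj_kernel_eq_disc_kernel:
  assumes "z \<noteq> 0"
  shows "conj_kernel (cmod z) (t - Arg z) = - disc_kernel (z * cis (-t))"
proof -
  let ?s = "t - Arg z" and ?r = "cmod z"
  have "z * cis (-t) = ?r * (cis (Arg z) * cis (-t))"
    using rcis_cmod_Arg[of z] by (simp add: rcis_def)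
  also have "\<dots> = ?r * cis (- ?s)" by (simp add: cis_mult)
  finally have u: "z * cis (-t) = ?r * cis (- ?s)" .
  have sq: "(cmod (1 - complex_of_real r * cis (- s)))\<^sup>2 = 1 - 2 * r * cos s + r\<^sup>2" for r s
  proof -
    have "(cmod (1 - complex_of_real r * cis (- s)))\<^sup>2 = (1 - r * cos s)\<^sup>2 + (r * sin s)\<^sup>2"
      unfolding cmod_power2 by simp
    also have "(1 - r * a)\<^sup>2 + (r * b)\<^sup>2 = 1 - 2 * r * a + r\<^sup>2 * (b\<^sup>2 + a\<^sup>2)" for a b :: real
      by (simp add: power2_eq_square algebra_simps)
    finally show ?thesis by simp
  qed
  show ?thesis
    unfolding disc_kernel_def conj_kernel_def u sq
    using assms sin_minus[of ?s] by (simp add: norm_mult)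
qed

text \<open>Along the ray s > 0 the argument stays \<open>Arg z\<close>, so the Poisson integral is
  \<open>poisson_polar\<close> at a fixed angle. This open half-line is a neighbourhood of
  \<open>cmod z\<close> because z \<noteq> 0.\<close>

lemma poisson_radial_deriv_eq:
  fixes F :: "complex \<Rightarrow> complex"
  assumes ac: "abs_continuous_on {0..2*pi} (\<lambda>t. F (cis t))"
    and deriv: "AE t in lborel. t \<in> {0..2*pi} \<longrightarrow>
                  ((\<lambda>t. F (cis t)) has_vector_derivative Fdot t) (at t)"
    and int: "set_integrable lborel {0..2*pi} Fdot"
    and z: "z \<noteq> 0" "cmod z < 1"
  shows "poisson_radial_deriv F z = (LINT t:{0..2*pi}|lborel. disc_kernel (z * cis (-t)) *\<^sub>R Fdot t)"
proof -
  have "((\<lambda>s. poisson_integral F (complex_of_real s * cis (Arg z))) has_vector_derivative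
     - (LINT t:{0..2*pi}|lborel. conj_kernel (cmod z) (t - Arg z) *\<^sub>R Fdot t)) (at (cmod z))"
  proof (rule has_vector_derivative_transform_within_open[where S = "{0<..}"])
    show "((\<lambda>r. poisson_polar F r (Arg z)) has_vector_derivative
     - (LINT t:{0..2*pi}|lborel. conj_kernel (cmod z) (t - Arg z) *\<^sub>R Fdot t)) (at (cmod z))"
      using z by (intro poisson_polar_has_radial_derivative[OF ac deriv int]) auto
    show "poisson_polar F s (Arg z) = poisson_integral F (complex_of_real s * cis (Arg z))" if "s \<in> {0<..}" for s
      using that Arg_bounded[of z] by (simp add: poisson_integral_def norm_mult Arg_times_of_real Arg_cis)
  qed (use z in auto)
  then have "poisson_radial_deriv F z = - (LINT t:{0..2*pi}|lborel. conj_kernel (cmod z) (t - Arg z) *\<^sub>R Fdot t)"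
    unfolding poisson_radial_deriv_def by (rule vector_derivative_at)
  also have "\<dots> = (LINT t:{0..2*pi}|lborel. disc_kernel (z * cis (-t)) *\<^sub>R Fdot t)"
    unfolding conj_kernel_eq_disc_kernel[OF z(1)] set_lebesgue_integral_def by simp
  finally show ?thesis .
qed

text \<open>Convexity on the open half-line. The end point x = 0 is separate: there the tangent has
  the value (1 - p) c^p \<le> 0.\<close>

lemma powr_above_tangent:
  fixes x c p :: real
  assumes "1 \<le> p" "0 < c" "0 \<le> x"
  shows "c powr p + p * c powr (p - 1) * (x - c) \<le> x powr p"
proof (cases "x = 0")
  case True
  have "c powr (p - 1) * c = c powr p" using assms by (simp add: powr_mult_base mult.commute)
  then have "c powr p + p * c powr (p - 1) * (x - c) = (1 - p) * c powr p"
    using True by (simp add: algebra_simps)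
  also have "\<dots> \<le> 0" using assms by (simp add: mult_nonpos_nonneg)
  finally show ?thesis using True by simp
next
  case False
  have "((\<lambda>x. x powr p) has_real_derivative p * c powr (p - 1)) (at c within {0<..})"
    using has_real_derivative_powr[OF \<open>0 < c\<close>] by (rule has_field_derivative_at_within)
  from convex_on_imp_above_tangent[OF powr_convex[OF \<open>1 \<le> p\<close>] _ _ _ this, of x]
  have "p * c powr (p - 1) * (x - c) \<le> x powr p - c powr p"
    using assms False by (simp add: interior_open)
  then show ?thesis by simp
qed

text \<open>Jensen without normalising the weight. The tangent inequality at the weighted mean
  \<open>c\<close> is multiplied by \<open>k\<close> and integrated; its linear part cancels,
  leaving c^p m on the left, and a factor m^(p-1) restores (c m)^p.\<close>

lemma weighted_Jensen_powr:
  fixes k x :: "'a \<Rightarrow> real"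
  assumes p: "1 \<le> p" and nonneg: "\<And>t. 0 \<le> k t" "\<And>t. 0 \<le> x t"
    and int: "integrable M k" "integrable M (\<lambda>t. k t * x t)" "integrable M (\<lambda>t. k t * x t powr p)"
    and pos: "0 < (\<integral>t. k t \<partial>M)"
  shows "(\<integral>t. k t * x t \<partial>M) powr p \<le> (\<integral>t. k t \<partial>M) powr (p - 1) * (\<integral>t. k t * x t powr p \<partial>M)"
proof -
  define m where "m = (\<integral>t. k t \<partial>M)"
  define c where "c = (\<integral>t. k t * x t \<partial>M) / m"
  have m: "0 < m" using pos by (simp add: m_def)
  have kx: "(\<integral>t. k t * x t \<partial>M) = c * m" using m by (simp add: c_def)
  have kx0: "0 \<le> (\<integral>t. k t * x t \<partial>M)" "0 \<le> (\<integral>t. k t * x t powr p \<partial>M)"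
    using nonneg by (auto intro!: Bochner_Integration.integral_nonneg)
  show ?thesis
  proof (cases "c = 0")
    case True
    then show ?thesis using kx kx0 by simp
  next
    case False
    have c: "0 < c" using False kx0 m by (simp add: c_def less_le)
    let ?q = "p * c powr (p - 1)"
    have "(\<integral>t. (c powr p - ?q * c) * k t + ?q * (k t * x t) \<partial>M) \<le> (\<integral>t. k t * x t powr p \<partial>M)"
    proof (rule integral_mono)
      show "(c powr p - ?q * c) * k t + ?q * (k t * x t) \<le> k t * x t powr p" for t
        using mult_left_mono[OF powr_above_tangent[OF p c nonneg(2)[of t]] nonneg(1)[of t]]
        by (simp add: algebra_simps)
    qed (use int in auto)
    also have "(\<integral>t. (c powr p - ?q * c) * k t + ?q * (k t * x t) \<partial>M) = (c powr p - ?q * c) * m + ?q * (c * m)"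
      using int by (simp add: kx m_def)
    also have "\<dots> = c powr p * m" by (simp add: algebra_simps)
    finally have *: "c powr p * m \<le> (\<integral>t. k t * x t powr p \<partial>M)" .
    have "(c * m) powr p = m powr (p - 1) * (c powr p * m)"
      using c m powr_mult_base[of m "p - 1"] by (simp add: powr_mult algebra_simps)
    also have "\<dots> \<le> m powr (p - 1) * (\<integral>t. k t * x t powr p \<partial>M)"
      by (intro mult_left_mono *) auto
    finally show ?thesis unfolding kx m_def[symmetric] .
  qed
qed

text \<open>On an interval of finite length this turns p-integrability of \<open>Fdot\<close> into
  integrability.\<close>

lemma le_one_plus_powr:
  fixes x p :: real
  assumes "1 \<le> p" "0 \<le> x"
  shows "x \<le> 1 + x powr p"
proof (cases "x \<le> 1")
  case True
  then show ?thesis by (simp add: add_increasing2)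
next
  case False
  then have "x powr 1 \<le> x powr p" using assms by (intro powr_mono) auto
  then show ?thesis using False by simp
qed

definition kernel_mass :: "real \<Rightarrow> real" where
  "kernel_mass r = 4 * artanh r / (pi * r)"

lemma borel_measurable_kernel_mass [measurable]: "kernel_mass \<in> borel_measurable borel"
  unfolding kernel_mass_def[abs_def] by measurable

lemma kernel_mass_pos:
  assumes "0 < r" "r < 1"
  shows "0 < kernel_mass r"
proof -
  have "1 < (1 + r) / (1 - r)" using assms by (simp add: less_divide_eq)
  then show ?thesis using assms by (simp add: kernel_mass_def artanh_def)
qed

lemma disc_kernel_slice:
  assumes z: "z \<noteq> 0" "cmod z < 1"
  shows "continuous_on S (\<lambda>t. disc_kernel (z * cis (-t)))"
    and "set_integrable lborel {0..2*pi} (\<lambda>t. \<bar>disc_kernel (z * cis (-t))\<bar>)"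
    and "(LINT t:{0..2*pi}|lborel. \<bar>disc_kernel (z * cis (-t))\<bar>) = kernel_mass (cmod z)"
proof -
  have eq: "disc_kernel (z * cis (-t)) = - conj_kernel (cmod z) (t - Arg z)" for t
    using conj_kernel_eq_disc_kernel[OF z(1)] by simp
  show cont: "continuous_on S (\<lambda>t. disc_kernel (z * cis (-t)))" for S
    unfolding eq using z by (intro continuous_intros continuous_on_conj_kernel) auto
  show int: "set_integrable lborel {0..2*pi} (\<lambda>t. \<bar>disc_kernel (z * cis (-t))\<bar>)"
    by (intro borel_integrable_atLeastAtMost' continuous_intros cont)
  have "\<bar>Arg z\<bar> \<le> 2 * pi" using Arg_bounded[of z] by auto
  then have "integral {0..2*pi} (\<lambda>t. \<bar>disc_kernel (z * cis (-t))\<bar>) = kernel_mass (cmod z)"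
    unfolding eq abs_minus_cancel kernel_mass_def using z by (intro integral_abs_conj_kernel) auto
  then show "(LINT t:{0..2*pi}|lborel. \<bar>disc_kernel (z * cis (-t))\<bar>) = kernel_mass (cmod z)"
    using set_borel_integral_eq_integral(2)[OF int] by simp
qed

text \<open>The factor that Jensen leaves in front of |dF/dt|^p, evaluated at u = z e^{-it}; |u| =
  |z|, so the mass can be written in terms of u. The indicator lets integrals run over the whole
  plane, where rotations act.\<close>

definition disc_weight :: "real \<Rightarrow> complex \<Rightarrow> real" where
  "disc_weight p u = indicator (ball 0 1) u * (kernel_mass (cmod u) powr (p - 1) * \<bar>disc_kernel u\<bar>)"

lemma borel_measurable_disc_weight [measurable]: "disc_weight p \<in> borel_measurable borel"
proof -
  have [measurable]: "ball (0::complex) 1 \<in> sets borel" by simp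
  show ?thesis unfolding disc_weight_def[abs_def] by measurable
qed

lemma nn_integral_disc_weight_slice:
  assumes p: "1 \<le> p"
  shows "(\<integral>\<^sup>+t. ennreal (disc_weight p (z * cis (-t))) * indicator {0..2*pi} t \<partial>lborel)
    = ennreal (kernel_mass (cmod z) powr p) * indicator (ball 0 1) z"
proof (cases "z \<noteq> 0 \<and> cmod z < 1")
  case True
  then have z: "z \<noteq> 0" "cmod z < 1" by auto
  let ?m = "kernel_mass (cmod z)"
  have "(\<integral>\<^sup>+t. ennreal (disc_weight p (z * cis (-t))) * indicator {0..2*pi} t \<partial>lborel)
     = (\<integral>\<^sup>+t. ennreal (?m powr (p - 1)) * ennreal (indicator {0..2*pi} t *\<^sub>R \<bar>disc_kernel (z * cis (-t))\<bar>) \<partial>lborel)"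
    using z by (intro nn_integral_cong) (auto simp: disc_weight_def norm_mult ennreal_mult indicator_def)
  also have "\<dots> = ennreal (?m powr (p - 1)) * (\<integral>\<^sup>+t. ennreal (indicator {0..2*pi} t *\<^sub>R \<bar>disc_kernel (z * cis (-t))\<bar>) \<partial>lborel)"
    by (rule nn_integral_cmult) measurable
  also have "(\<integral>\<^sup>+t. ennreal (indicator {0..2*pi} t *\<^sub>R \<bar>disc_kernel (z * cis (-t))\<bar>) \<partial>lborel) = ennreal ?m"
    using disc_kernel_slice(2,3)[OF z] unfolding set_integrable_def set_lebesgue_integral_def
    by (subst nn_integral_eq_integral) auto
  also have "ennreal (?m powr (p - 1)) * ennreal ?m = ennreal (?m powr p)"
    using kernel_mass_pos[of "cmod z"] z powr_mult_base[of ?m "p - 1"]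
    by (simp add: mult.commute flip: ennreal_mult)
  finally show ?thesis using z by simp
next
  \<comment> \<open>At z = 0 both sides vanish because division by zero gives
    \<open>disc_kernel 0 = 0\<close> and \<open>kernel_mass 0 = 0\<close>; outside the disc the
    indicators vanish.\<close>
  case False
  have "disc_weight p (z * cis (-t)) = 0" for t
    using False by (auto simp: disc_weight_def disc_kernel_def norm_mult)
  moreover have "ennreal (kernel_mass (cmod z) powr p) * indicator (ball 0 1) z = 0"
    using False p by (auto simp: kernel_mass_def)
  ultimately show ?thesis by simp
qed

lemma C_const_altdef: "C_const p = (\<integral>r. indicator {0<..<1} r *\<^sub>R (kernel_mass r powr p * r) \<partial>lborel)"
proof -
  have "einterval 0 1 = {0<..<1::real}" by (auto simp: einterval_iff)
  then show ?thesis
    by (simp add: C_const_def interval_lebesgue_integral_def set_lebesgue_integral_def kernel_mass_def)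
qed

lemma C_const_nonneg: "0 \<le> C_const p"
  unfolding C_const_altdef by (intro Bochner_Integration.integral_nonneg) (auto simp: indicator_def)

text \<open>The weight is not rotation invariant, but its integral over the disc can be computed by first
  averaging it over all rotations.\<close>

lemma nn_integral_disc_weight:
  assumes p: "1 \<le> p"
  shows "(\<integral>\<^sup>+u. ennreal (disc_weight p u) \<partial>lborel) = ennreal (C_const p)" (is "?J = _")
proof -
  \<comment> \<open>By rotation invariance the integral of the weight composed with any rotation is
    again \<open>?J\<close>; integrating this constant over a period gives 2 pi \<open>?J\<close>,
    later matched with the 2 pi of the area element.\<close>
  have "ennreal (2 * pi) * ?J = (\<integral>\<^sup>+t. ?J * indicator {0..2*pi} t \<partial>lborel)"
    by (simp add: nn_integral_cmult mult.commute)
  also have "\<dots> = (\<integral>\<^sup>+t. (\<integral>\<^sup>+z. ennreal (disc_weight p (z * cis (-t))) \<partial>lborel) * indicator {0..2*pi} t \<partial>lborel)"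
    by (subst nn_integral_rotate) auto
  also have "\<dots> = (\<integral>\<^sup>+t. \<integral>\<^sup>+z. ennreal (disc_weight p (z * cis (-t))) * indicator {0..2*pi} t \<partial>lborel \<partial>lborel)"
    by (subst nn_integral_multc) auto
  also have "\<dots> = (\<integral>\<^sup>+z. \<integral>\<^sup>+t. ennreal (disc_weight p (z * cis (-t))) * indicator {0..2*pi} t \<partial>lborel \<partial>lborel)"
    by (rule lborel_pair.Fubini') measurable
  also have "\<dots> = (\<integral>\<^sup>+z. ennreal (kernel_mass (cmod z) powr p) * indicator (ball 0 1) z \<partial>lborel)"
    by (simp only: nn_integral_disc_weight_slice[OF p])
  also have "\<dots> = (\<integral>\<^sup>+r. ennreal (2 * pi * r) * ennreal (kernel_mass r powr p) * indicator {0<..<1} r \<partial>lborel)"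
    by (rule nn_integral_cmod_disc) measurable
  also have "\<dots> = (\<integral>\<^sup>+r. ennreal (2 * pi) * ennreal (indicator {0<..<1} r *\<^sub>R (kernel_mass r powr p * r)) \<partial>lborel)"
    by (intro nn_integral_cong) (auto simp: indicator_def ennreal_mult[symmetric] mult_ac)
  also have "\<dots> = ennreal (2 * pi) * (\<integral>\<^sup>+r. ennreal (indicator {0<..<1} r *\<^sub>R (kernel_mass r powr p * r)) \<partial>lborel)"
    by (rule nn_integral_cmult) measurable
  also have "(\<integral>\<^sup>+r. ennreal (indicator {0<..<1} r *\<^sub>R (kernel_mass r powr p * r)) \<partial>lborel) = ennreal (C_const p)"
    unfolding C_const_altdef
    using set_integrable_artanh_powr[OF p] unfolding set_integrable_def kernel_mass_def[symmetric]
    by (intro nn_integral_eq_integral) (auto simp: indicator_def)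
  finally show ?thesis by (auto simp: ennreal_mult_cancel_left)
qed

text \<open>Jensen for the density |disc_kernel (z e^{-it})| on [0, 2 pi], of total mass
  \<open>kernel_mass (cmod z)\<close>. For fixed z in the disc the kernel is bounded there, so
  multiplication by it preserves integrability.\<close>

lemma disc_kernel_transform_bound:
  fixes f :: "real \<Rightarrow> complex"
  assumes p: "1 \<le> p" and z: "z \<noteq> 0" "cmod z < 1"
    and f: "integrable lborel f" "integrable lborel (\<lambda>t. norm (f t) powr p)"
    and supp: "\<And>t. t \<notin> {0..2*pi} \<Longrightarrow> f t = 0"
  shows "ennreal (norm (\<integral>t. disc_kernel (z * cis (-t)) *\<^sub>R f t \<partial>lborel) powr p)
    \<le> (\<integral>\<^sup>+t. ennreal (disc_weight p (z * cis (-t))) * ennreal (norm (f t) powr p) \<partial>lborel)"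
proof -
  let ?k = "\<lambda>t. indicator {0..2*pi} t * \<bar>disc_kernel (z * cis (-t))\<bar>"
  let ?m = "kernel_mass (cmod z)"
  have [measurable]: "f \<in> borel_measurable lborel" using f by auto
  obtain C where C: "C > 0" "\<And>t. t \<in> {0..2*pi} \<Longrightarrow> \<bar>disc_kernel (z * cis (-t))\<bar> \<le> C"
    using compact_imp_bounded[OF compact_continuous_image[OF disc_kernel_slice(1)[OF z, of "{0..2*pi}"] compact_Icc]]
    by (auto simp: bounded_pos)
  then have k: "?k t \<le> C" "0 \<le> ?k t" for t by (auto simp: indicator_def)
  have kint: "integrable lborel ?k" "(\<integral>t. ?k t \<partial>lborel) = ?m"
    using disc_kernel_slice(2,3)[OF z] by (simp_all add: set_integrable_def set_lebesgue_integral_def)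
  have kf: "integrable lborel (\<lambda>t. ?k t * g t)" if "integrable lborel g" for g :: "real \<Rightarrow> real"
  proof (rule Bochner_Integration.integrable_bound)
    show "integrable lborel (\<lambda>t. C * g t)" using that by simp
    show "AE t in lborel. norm (?k t * g t) \<le> norm (C * g t)"
      using k C(1) by (auto simp: abs_mult intro!: AE_I2 mult_right_mono)
    have [measurable]: "g \<in> borel_measurable lborel" using that by auto
    show "(\<lambda>t. ?k t * g t) \<in> borel_measurable lborel" by measurable
  qed
  have kpf: "integrable lborel (\<lambda>t. ?k t * norm (f t) powr p)" by (rule kf[OF f(2)])
  have m: "0 < ?m" using z by (intro kernel_mass_pos) auto
  have "norm (\<integral>t. disc_kernel (z * cis (-t)) *\<^sub>R f t \<partial>lborel) \<le> (\<integral>t. norm (disc_kernel (z * cis (-t)) *\<^sub>R f t) \<partial>lborel)"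
    by (rule integral_norm_bound)
  also have "\<dots> = (\<integral>t. ?k t * norm (f t) \<partial>lborel)"
    using supp by (intro Bochner_Integration.integral_cong refl) (auto simp: indicator_def)
  finally have "norm (\<integral>t. disc_kernel (z * cis (-t)) *\<^sub>R f t \<partial>lborel) powr p \<le> (\<integral>t. ?k t * norm (f t) \<partial>lborel) powr p"
    using p by (intro powr_mono2) auto
  also have "\<dots> \<le> ?m powr (p - 1) * (\<integral>t. ?k t * norm (f t) powr p \<partial>lborel)"
    using weighted_Jensen_powr[OF p, of ?k "\<lambda>t. norm (f t)" lborel] k kint kf[OF integrable_norm[OF f(1)]] kpf m
    by simp
  finally have "ennreal (norm (\<integral>t. disc_kernel (z * cis (-t)) *\<^sub>R f t \<partial>lborel) powr p)
     \<le> ennreal (?m powr (p - 1)) * ennreal (\<integral>t. ?k t * norm (f t) powr p \<partial>lborel)"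
    by (simp add: ennreal_leI flip: ennreal_mult')
  also have "ennreal (\<integral>t. ?k t * norm (f t) powr p \<partial>lborel) = (\<integral>\<^sup>+t. ennreal (?k t * norm (f t) powr p) \<partial>lborel)"
    using k kpf by (intro nn_integral_eq_integral[symmetric]) auto
  also have "ennreal (?m powr (p - 1)) * \<dots> = (\<integral>\<^sup>+t. ennreal (?m powr (p - 1)) * ennreal (?k t * norm (f t) powr p) \<partial>lborel)"
    by (rule nn_integral_cmult[symmetric]) measurable
  also have "\<dots> = (\<integral>\<^sup>+t. ennreal (disc_weight p (z * cis (-t))) * ennreal (norm (f t) powr p) \<partial>lborel)"
    using z supp p
    by (intro nn_integral_cong) (auto simp: disc_weight_def norm_mult indicator_def ennreal_mult[symmetric] mult_ac)
  finally show ?thesis .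
qed

theorem theorem1p1:
  fixes p :: real and F :: "complex \<Rightarrow> complex" and Fdot :: "real \<Rightarrow> complex"
  assumes p: "1 \<le> p"
    and ac: "abs_continuous_on {0..2*pi} (\<lambda>t. F (cis t))"
    and deriv: "AE t in lborel. t \<in> {0..2*pi} \<longrightarrow>
                  ((\<lambda>t. F (cis t)) has_vector_derivative Fdot t) (at t)"
    and meas: "set_borel_measurable lborel {0..2*pi} Fdot"
    and Lp: "set_integrable lborel {0..2*pi} (\<lambda>t. norm (Fdot t) powr p)"
  shows "set_integrable lborel {0<..<1} (\<lambda>r::real. (4 * artanh r / (pi * r)) powr p * r) \<and>
         set_integrable lborel (ball 0 1) (\<lambda>z. norm (poisson_radial_deriv F z) powr p) \<and>
         bergman_Lp_norm p (poisson_radial_deriv F)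
           \<le> (2 * C_const p) powr (1/p) * circle_Lp_norm p Fdot"
proof (intro conjI)
  show "set_integrable lborel {0<..<1} (\<lambda>r::real. (4 * artanh r / (pi * r)) powr p * r)"
    by (rule set_integrable_artanh_powr[OF p])
  define f where "f t = indicator {0..2*pi} t *\<^sub>R Fdot t" for t
  define N where "N = (\<integral>t. norm (f t) powr p \<partial>lborel)"
  define W where "W z = (\<integral>t. disc_kernel (z * cis (-t)) *\<^sub>R f t \<partial>lborel)" for z
  have fp: "norm (f t) powr p = indicator {0..2*pi} t *\<^sub>R norm (Fdot t) powr p" for t
    using p by (simp add: f_def indicator_def)
  have [measurable]: "f \<in> borel_measurable lborel"
    using meas unfolding set_borel_measurable_def f_def[abs_def] .
  have fpint: "integrable lborel (\<lambda>t. norm (f t) powr p)"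
    using Lp unfolding fp set_integrable_def .
  have N0: "0 \<le> N" by (simp add: N_def)
  have fint: "integrable lborel f"
  proof (rule Bochner_Integration.integrable_bound)
    have "integrable lborel (\<lambda>t. indicator {0..2*pi} t + norm (f t) powr p :: real)"
      using fpint by (intro Bochner_Integration.integrable_add) auto
    then show "integrable lborel (\<lambda>t. indicator {0..2*pi} t + norm (f t) powr p :: real)" .
    show "AE t in lborel. norm (f t) \<le> norm (indicator {0..2*pi} t + norm (f t) powr p)"
      using le_one_plus_powr[OF p] by (auto simp: f_def indicator_def intro!: AE_I2)
  qed measurable
  have [measurable]: "W \<in> borel_measurable borel"
    unfolding W_def[abs_def] by measurable
  have radial: "poisson_radial_deriv F z = W z" if "z \<noteq> 0" "cmod z < 1" for z
  proof -
    have "set_integrable lborel {0..2*pi} Fdot" using fint unfolding set_integrable_def f_def[abs_def] .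
    from poisson_radial_deriv_eq[OF ac deriv this that] show ?thesis
      by (simp add: W_def f_def set_lebesgue_integral_def mult_ac scaleR_left_commute)
  qed
  let ?w = "\<lambda>z. indicator (ball 0 1) z *\<^sub>R norm (poisson_radial_deriv F z) powr p"
  have [measurable]: "?w \<in> borel_measurable lborel"
  proof -
    \<comment> \<open>The formula for w_r is known only off the origin; whatever value occurs at
      that one point leaves the function measurable.\<close>
    have "?w = (\<lambda>z. if z = 0 then norm (poisson_radial_deriv F 0) powr p
        else indicator (ball 0 1) z *\<^sub>R norm (W z) powr p)"
    proof
      fix z show "?w z = (if z = 0 then norm (poisson_radial_deriv F 0) powr p
        else indicator (ball 0 1) z *\<^sub>R norm (W z) powr p)"
        using radial[of z] by (cases "z = 0"; cases "cmod z < 1") simp_all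
    qed
    moreover have [measurable]: "ball (0::complex) 1 \<in> sets borel" by simp
    have "(\<lambda>z. if z = 0 then norm (poisson_radial_deriv F 0) powr p
        else indicator (ball 0 1) z *\<^sub>R norm (W z) powr p) \<in> borel_measurable lborel"
      by measurable
    ultimately show ?thesis by simp
  qed
  have bound: "(\<integral>\<^sup>+z. ennreal (?w z) \<partial>lborel) \<le> ennreal (C_const p * N)"
  proof -
    have "(\<integral>\<^sup>+z. ennreal (?w z) \<partial>lborel)
       \<le> (\<integral>\<^sup>+z. \<integral>\<^sup>+t. ennreal (disc_weight p (z * cis (-t))) * ennreal (norm (f t) powr p) \<partial>lborel \<partial>lborel)"
    proof (rule nn_integral_mono_AE)
      have "AE z in lborel. z \<noteq> (0::complex)" by (rule AE_lborel_singleton)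
      then show "AE z in lborel. ennreal (?w z)
         \<le> (\<integral>\<^sup>+t. ennreal (disc_weight p (z * cis (-t))) * ennreal (norm (f t) powr p) \<partial>lborel)"
      proof eventually_elim
        case (elim z)
        show ?case
        proof (cases "cmod z < 1")
          case True
          then show ?thesis
            using disc_kernel_transform_bound[OF p elim True fint fpint] radial[OF elim True]
            by (simp add: W_def f_def)
        qed simp
      qed
    qed
    also have "\<dots> = (\<integral>\<^sup>+t. \<integral>\<^sup>+z. ennreal (disc_weight p (z * cis (-t))) * ennreal (norm (f t) powr p) \<partial>lborel \<partial>lborel)"
      by (rule lborel_pair.Fubini') measurable
    also have "\<dots> = (\<integral>\<^sup>+t. (\<integral>\<^sup>+z. ennreal (disc_weight p (z * cis (-t))) \<partial>lborel) * ennreal (norm (f t) powr p) \<partial>lborel)"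
      by (subst nn_integral_multc) auto
    \<comment> \<open>Rotation invariance removes t from the inner integral, whose value is
      C(p).\<close>
    also have "\<dots> = (\<integral>\<^sup>+t. ennreal (C_const p) * ennreal (norm (f t) powr p) \<partial>lborel)"
      by (subst nn_integral_rotate) (auto simp: nn_integral_disc_weight[OF p])
    also have "\<dots> = ennreal (C_const p) * (\<integral>\<^sup>+t. ennreal (norm (f t) powr p) \<partial>lborel)"
      by (rule nn_integral_cmult) measurable
    also have "(\<integral>\<^sup>+t. ennreal (norm (f t) powr p) \<partial>lborel) = ennreal N"
      unfolding N_def by (intro nn_integral_eq_integral fpint) auto
    finally show ?thesis using C_const_nonneg[of p] N0 by (simp add: ennreal_mult)
  qed
  have wint: "integrable lborel ?w"
  proof (rule integrableI_bounded)
    have "(\<integral>\<^sup>+z. ennreal (norm (?w z)) \<partial>lborel) = (\<integral>\<^sup>+z. ennreal (?w z) \<partial>lborel)"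
      by (intro nn_integral_cong) auto
    also have "\<dots> < \<infinity>" using bound by (rule le_less_trans) simp
    finally show "(\<integral>\<^sup>+z. ennreal (norm (?w z)) \<partial>lborel) < \<infinity>" .
  qed measurable
  then show "set_integrable lborel (ball 0 1) (\<lambda>z. norm (poisson_radial_deriv F z) powr p)"
    by (simp add: set_integrable_def)
  have w_le: "(\<integral>z. ?w z \<partial>lborel) \<le> C_const p * N"
  proof -
    have "ennreal (\<integral>z. ?w z \<partial>lborel) = (\<integral>\<^sup>+z. ennreal (?w z) \<partial>lborel)"
      by (rule nn_integral_eq_integral[symmetric, OF wint]) auto
    with bound have "ennreal (\<integral>z. ?w z \<partial>lborel) \<le> ennreal (C_const p * N)" by simp
    then show ?thesis
      using C_const_nonneg[of p] N0 by (subst (asm) ennreal_le_iff) auto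
  qed
  have circle: "circle_Lp_norm p Fdot = ((1/(2*pi)) * N) powr (1/p)"
    unfolding circle_Lp_norm_def N_def fp
    by (simp add: zero_ereal_def interval_integral_Icc set_lebesgue_integral_def)
  have "bergman_Lp_norm p (poisson_radial_deriv F) = ((1/pi) * (\<integral>z. ?w z \<partial>lborel)) powr (1/p)"
    by (simp add: bergman_Lp_norm_def set_lebesgue_integral_def)
  \<comment> \<open>The two normalisations meet: (1/pi) C(p) N = 2 C(p) * N / (2 pi).\<close>
  also have "\<dots> \<le> ((2 * C_const p) * ((1/(2*pi)) * N)) powr (1/p)"
    using w_le p by (intro powr_mono2) (auto simp: divide_right_mono intro!: Bochner_Integration.integral_nonneg)
  also have "\<dots> = (2 * C_const p) powr (1/p) * circle_Lp_norm p Fdot"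
    unfolding circle by (rule powr_mult)
  finally show "bergman_Lp_norm p (poisson_radial_deriv F)
           \<le> (2 * C_const p) powr (1/p) * circle_Lp_norm p Fdot" .
qed

end
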